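(* Let $p$ and $q$ be positive prime numbers with $p\equiv 5 \pmod 8$ and $q\equiv 1 \pmod 8$. Then the equation $$2^x+p^y=q^z$$ has at most one solution in positive integers $(x,y,z)$. *)

theory Defs
  imports Complex_Main "HOL-Number_Theory.Number_Theory"
begin

end

theory Submission
  imports Defs
begin

text \<open>
  Modulo \<^term>\<open>8\<close> a solution has either \<open>x = 2\<close> and \<open>y\<close> odd, or \<open>x \<ge> 3\<close> and \<open>y\<close> even, and factoring
  \<open>q^z - 2^x\<close> or \<open>q^z - p^y\<close> as a difference of squares shows that \<open>z\<close> is odd. Since \<open>2\<close> is a
  non-residue modulo \<open>p\<close>, the parity of \<open>x\<close> is determined by \<open>p\<close> and \<open>q\<close>.

  The two types with \<open>x\<close> even exclude each other. From \<open>4 + p^y = q^z\<close> the prime \<open>p\<close> is a quartic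
  residue modulo \<open>q\<close>. If also \<open>4^j + p^(2k) = q^z'\<close>, then congruences modulo \<open>p\<close>, \<open>3\<close> and \<open>5\<close> make \<open>j\<close>
  and \<open>k\<close> odd, and \<open>(p^k - 2^j)^2\<close> is congruent to \<open>-2^(j+1) p^k\<close> modulo \<open>q\<close>. Hence \<open>N = \<bar>p^k - 2^j\<bar>\<close> is a
  quadratic residue modulo \<open>q\<close>, while reciprocity gives \<open>(N/q) = (2/N) = -1\<close>.

  Within one type, each solution is an element \<open>a + b \<surd>-D\<close> of norm \<open>q^z\<close> with \<open>D\<close> one of \<open>p\<close>, \<open>1\<close>, \<open>2\<close>.
  All such elements with \<open>a\<close>, \<open>b\<close> coprime and \<open>z\<close> odd are odd powers \<open>\<gamma>^n\<close> of elements \<open>\<gamma> = c + d \<surd>-D\<close> of one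
  common norm \<open>q^h\<close>. As \<open>c\<close> divides \<open>a\<close> and \<open>d\<close> divides \<open>b\<close>, a \<open>p\<close>-adic (in one case \<open>2\<close>-adic)
  estimate of the binomial expansion of \<open>\<gamma>^n\<close> forces \<open>n = 1\<close>, so \<open>z = h\<close>.
\<close>

section \<open>Quadratic residues and parity constraints\<close>

text \<open>Gauss's lemma: the multiples 2, 4, ..., p - 1 are already reduced modulo
  \<open>p\<close>, and \<open>m - m div 2\<close> of them exceed \<open>m\<close>; the parity of
  this count depends only on \<open>p\<close> modulo 8.\<close>

lemma Legendre_2:
  fixes p :: nat
  assumes "prime p" "2 < p"
  shows "Legendre 2 (int p) = (if p mod 8 = 1 \<or> p mod 8 = 7 then 1 else -1)"
proof -
  have odd: "odd p" using assms prime_odd_nat by auto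
  interpret G: GAUSS p 2
    using assms by unfold_locales (auto simp: cong_def)
  define m where "m = (int p - 1) div 2"
  have p: "int p = 2 * m + 1" using odd by (simp add: m_def)
  have "G.C = (*) 2 ` {0<..m}"
    unfolding G.C_def G.B_def G.A_def image_image m_def[symmetric]
    by (rule image_cong) (auto simp: p)
  then have "G.E = (*) 2 ` {m div 2<..m}"
    unfolding G.E_def m_def[symmetric] using assms(2) p by auto
  then have card: "card G.E = nat (m - m div 2)"
    by (simp add: card_image inj_on_def)
  have r: "p mod 8 = 1 \<or> p mod 8 = 3 \<or> p mod 8 = 5 \<or> p mod 8 = 7"
    using odd by presburger
  have "even (m - m div 2) \<longleftrightarrow> p mod 8 = 1 \<or> p mod 8 = 7"
    using r p by presburger
  then have "even (nat (m - m div 2)) \<longleftrightarrow> p mod 8 = 1 \<or> p mod 8 = 7"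
    using p assms(2) by (subst even_nat_iff) auto
  then show ?thesis
    using G.gauss_lemma card by auto
qed

text \<open>With \<open>w\<close> = (p - 1)/4, Euler's criterion gives 4^w = (2/p) = -1 modulo
  \<open>p\<close>, so raising to the power \<open>w\<close> turns 4^n into (-1)^n.\<close>

lemma four_power_cong_imp_parity:
  fixes p :: nat
  assumes "prime p" "[p = 5] (mod 8)" "[4 ^ u = 4 ^ v] (mod int p)"
  shows "even u \<longleftrightarrow> even v"
proof -
  have p8: "p mod 8 = 5" using assms(2) by (simp add: cong_def)
  then have p2: "p > 2" using mod_less_eq_dividend[of p 8] by linarith
  define w where "w = (p - 1) div 4"
  obtain t where "p = 8 * t + 5" using p8 by (metis mult_div_mod_eq)
  then have w: "(p - 1) div 2 = 2 * w" by (simp add: w_def)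
  have "[(4::int) ^ w = -1] (mod int p)"
    using euler_criterion[OF assms(1) p2, of 2] Legendre_2[OF assms(1) p2] p8 w
    by (simp add: power_mult cong_sym_eq)
  then have *: "[(4 ^ n) ^ w = (-1) ^ n] (mod int p)" for n
    using cong_pow[of "4 ^ w" "-1" "int p" n] by (simp add: power_mult[symmetric] mult.commute)
  have "[(-1) ^ u = (-1) ^ v] (mod int p)"
    using cong_pow[OF assms(3), of w] * by (meson cong_sym cong_trans)
  then have "int p dvd (-1) ^ u - (-1) ^ v" by (simp add: cong_iff_dvd_diff)
  moreover have "\<not> int p dvd 2" "\<not> int p dvd -2"
    using p2 by (auto dest: zdvd_imp_le)
  ultimately show ?thesis
    by (cases "even u"; cases "even v") auto
qed

lemma odd_square_mod_8: "odd (n::nat) \<Longrightarrow> n\<^sup>2 mod 8 = 1"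
proof -
  assume "odd n"
  then obtain k where "n = 2 * k + 1" by (elim oddE)
  moreover have "even (k * (k + 1))" by simp
  then obtain l where "k * (k + 1) = 2 * l" by (elim evenE)
  ultimately have "n\<^sup>2 = 8 * l + 1" by (simp add: power2_eq_square algebra_simps)
  then show ?thesis by simp
qed

lemma odd_power_mod_8: "odd (n::nat) \<Longrightarrow> n ^ k mod 8 = (if even k then 1 else n mod 8)"
proof -
  assume n: "odd n"
  have *: "n ^ (2 * j) mod 8 = 1" for j
    using odd_square_mod_8[of "n ^ j"] n by (simp add: power_mult mult.commute[of 2])
  show ?thesis
  proof (cases "even k")
    case True
    then show ?thesis using * by auto
  next
    case False
    then obtain j where "k = 2 * j + 1" by (elim oddE)
    then show ?thesis using * mod_mult_right_eq[of n "n ^ (2*j)" 8] by simp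
  qed
qed

lemma prime_power_mult_eq_prime_power:
  fixes p a b :: nat
  assumes "prime p" "a * b = p ^ n" "\<not> p dvd a"
  shows "a = 1"
proof -
  have "a dvd p ^ n" using assms(2) by (metis dvd_triv_left)
  then obtain i where "a = p ^ i" using assms(1) divides_primepow_nat by blast
  with assms(3) show ?thesis by (cases i) auto
qed

section \<open>Solutions modulo 8 and the parity of z\<close>

definition sol :: "nat \<Rightarrow> nat \<Rightarrow> nat \<Rightarrow> nat \<Rightarrow> nat \<Rightarrow> bool" where
  "sol p q x y z \<longleftrightarrow> x > 0 \<and> y > 0 \<and> z > 0 \<and> 2 ^ x + p ^ y = q ^ z"

locale prime_pair =
  fixes p q :: nat
  assumes p: "prime p" and q: "prime q"
    and p5: "[p = 5] (mod 8)" and q1: "[q = 1] (mod 8)"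
begin

lemma p_mod: "p mod 8 = 5" and q_mod: "q mod 8 = 1"
  using p5 q1 by (auto simp: cong_def)

lemma odd_p: "odd p" and odd_q: "odd q"
  using p_mod q_mod by presburger+

lemma p_ge: "p \<ge> 5"
  using p_mod mod_less_eq_dividend[of p 8] by linarith

lemma q_ge: "q \<ge> 17"
proof -
  have "q \<noteq> 1" "q \<noteq> 9" using q by (auto simp: prime_nat_iff dest: spec[of _ 3])
  then show ?thesis using q_mod by presburger
qed

lemma q_power_mod: "q ^ n mod 8 = 1"
  using odd_power_mod_8[OF odd_q, of n] q_mod by auto

lemma p_power_mod: "p ^ n mod 8 = (if even n then 1 else 5)"
  using odd_power_mod_8[OF odd_p, of n] p_mod by auto

lemma sol_cases:
  assumes "sol p q x y z"
  obtains "x = 2" "odd y" | "x \<ge> 3" "even y"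
proof -
  have s: "(2 ^ x + p ^ y) mod 8 = 1" "x > 0"
    using assms q_power_mod by (auto simp: sol_def)
  have "x = 1 \<or> x = 2 \<or> x = 3 + (x - 3)" using s(2) by linarith
  then consider "x = 1" | "x = 2" | k where "x = 3 + k" by blast
  then show ?thesis
  proof cases
    case 1
    have "(2 + p ^ y mod 8) mod 8 = 1" using s 1 by (simp add: mod_simps)
    then show ?thesis using p_power_mod[of y] by (auto split: if_splits)
  next
    case 2
    have "(4 + p ^ y mod 8) mod 8 = 1" using s 2 by (simp add: mod_simps)
    then have "odd y" using p_power_mod[of y] by (auto split: if_splits)
    then show ?thesis using 2 that(1) by simp
  next
    case 3
    have e: "(2::nat) ^ x = 8 * 2 ^ k" unfolding 3 by (simp add: power_add)
    have "p ^ y mod 8 = (8 * 2 ^ k + p ^ y) mod 8" by (rule mod_mult_self4[symmetric])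
    also have "\<dots> = 1" using s(1) unfolding e .
    finally have "p ^ y mod 8 = 1" .
    then have "even y" using p_power_mod[of y] by (metis numeral_eq_one_iff semiring_norm(86))
    then show ?thesis using 3 that(2) by simp
  qed
qed

lemma sol_odd_z:
  assumes "sol p q x y z"
  shows "odd z"
proof
  assume "even z"
  then obtain w where w: "z = 2 * w" by (elim evenE)
  have eq: "2 ^ x + p ^ y = q ^ w * q ^ w" and pos: "y > 0" "w > 0"
    using assms by (auto simp: sol_def w mult_2 power_add)
  have "q ^ 1 \<le> q ^ w" using pos(2) q_ge by (intro power_increasing) auto
  then have Q: "q ^ w \<ge> 17" using q_ge by simp
  from assms show False
  proof (cases rule: sol_cases)
    case 1
    \<comment> \<open>Neither factor is 1, so \<open>p\<close> divides both and hence their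
      difference 4.\<close>
    have e: "(q ^ w - 2) * (q ^ w + 2) = p ^ y"
      using eq 1 Q by (simp add: diff_mult_distrib algebra_simps)
    have "p dvd q ^ w - 2"
      using prime_power_mult_eq_prime_power[OF p e] Q by fastforce
    moreover have "p dvd q ^ w + 2"
      using prime_power_mult_eq_prime_power[OF p e[unfolded mult.commute[of "q ^ w - 2"]]] Q by fastforce
    ultimately have "p dvd (q ^ w + 2) - (q ^ w - 2)" by (rule dvd_diff_nat[rotated])
    then have "p dvd 4" using Q by simp
    then have "p \<le> 4" by (auto dest: dvd_imp_le)
    then show False using p_ge by simp
  next
    case 2
    then obtain k where k: "y = 2 * k" by (elim evenE)
    have lt: "p ^ k < q ^ w"
    proof (rule power_less_imp_less_base[of _ 2])
      show "(p ^ k) ^ 2 < (q ^ w) ^ 2" using eq k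
        by (simp add: power2_eq_square mult_2 power_add flip: eq)
    qed simp
    have e: "(q ^ w - p ^ k) * (q ^ w + p ^ k) = 2 ^ x"
    proof -
      obtain d where d: "q ^ w = p ^ k + d" using lt by (metis less_imp_add_positive)
      have "(q ^ w - p ^ k) * (q ^ w + p ^ k) = q ^ w * q ^ w - p ^ k * p ^ k"
        by (simp add: d algebra_simps)
      also have "\<dots> = 2 ^ x" by (simp add: k mult_2 power_add flip: eq)
      finally show ?thesis .
    qed
    have "q ^ w - p ^ k dvd 2 ^ x" "q ^ w + p ^ k dvd 2 ^ x"
      using e by (metis dvd_triv_left dvd_triv_right)+
    then obtain i j where ij: "q ^ w - p ^ k = 2 ^ i" "q ^ w + p ^ k = 2 ^ j"
      using divides_primepow_nat[OF two_is_prime_nat] by metis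
    \<comment> \<open>Both factors are powers of 2. The case \<open>i = 0\<close> fails by parity,
      \<open>i = 1\<close> makes q^w equal 3 or 7 modulo 8, and \<open>i \<ge> 2\<close> makes 4
      divide 2 p^k.\<close>
    have sum: "2 * p ^ k + 2 ^ i = 2 ^ j" using ij lt by linarith
    have "odd (p ^ k)" using odd_p by simp
    have pk: "p ^ k mod 8 = 1 \<or> p ^ k mod 8 = 5" using p_power_mod[of k] by auto
    have qe: "q ^ w = 2 ^ i + p ^ k" using ij lt by linarith
    have "i = 0 \<or> i = 1 \<or> i = 2 + (i - 2)" by linarith
    then consider "i = 0" | "i = 1" | l where "i = 2 + l" by blast
    then show False
    proof cases
      case 1
      have "odd (q ^ w)" using odd_q by simp
      then show False using qe 1 \<open>odd (p ^ k)\<close> by simp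
    next
      case 2
      have "(2 + p ^ k mod 8) mod 8 = 1" using qe 2 q_power_mod[of w] by (simp add: mod_simps)
      then show False using pk by auto
    next
      case 3
      have "(2::nat) ^ 3 \<le> 2 ^ j" using ij Q by simp
      then have "j \<ge> 3" by (simp only: power_increasing_iff)
      then have "4 dvd (2::nat) ^ j" using le_imp_power_dvd[of 2 j "2::nat"] by simp
      moreover have "4 dvd (2::nat) ^ i" using 3 by (simp add: power_add)
      ultimately have "4 dvd 2 * p ^ k" 
        using dvd_add_left_iff[of 4 "2 ^ i" "2 * p ^ k"] sum by simp
      then have "even (p ^ k)" using dvd_times_left_cancel_iff[of 2 2 "p ^ k"] by simp
      then show False using \<open>odd (p ^ k)\<close> by simp
    qed
  qed
qed

end

section \<open>Solutions of the two types with x even exclude each other\<close>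

text \<open>The Jacobi symbol (2/n) for odd \<open>n\<close>, given by its values modulo 8.\<close>

definition chi8 :: "nat \<Rightarrow> int" where
  "chi8 n = (if n mod 8 = 1 \<or> n mod 8 = 7 then 1 else -1)"

lemma chi8_mult:
  assumes "odd a" "odd b"
  shows "chi8 (a * b) = chi8 a * chi8 b"
proof -
  have "a mod 8 = 1 \<or> a mod 8 = 3 \<or> a mod 8 = 5 \<or> a mod 8 = 7"
    "b mod 8 = 1 \<or> b mod 8 = 3 \<or> b mod 8 = 5 \<or> b mod 8 = 7"
    using assms by presburger+
  moreover have "a * b mod 8 = (a mod 8) * (b mod 8) mod 8" by (simp add: mod_mult_eq)
  ultimately show ?thesis unfolding chi8_def by (elim disjE) simp_all
qed

text \<open>Both sides are multiplicative on odd numbers, so prime factors suffice. This carries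
  Legendre symbols of primes over to a composite \<open>n\<close>.\<close>

lemma power_cong_chi8:
  assumes "odd n" "\<And>r. prime r \<Longrightarrow> r dvd n \<Longrightarrow> [int r ^ w = chi8 r] (mod M)"
  shows "[int n ^ w = chi8 n] (mod M)"
  using assms
proof (induction n rule: prime_divisors_induct)
  case (factor r n)
  then have "[int r ^ w * int n ^ w = chi8 r * chi8 n] (mod M)"
    by (intro cong_mult) auto
  with factor show ?case by (simp add: power_mult_distrib chi8_mult)
qed (auto simp: chi8_def)

text \<open>An odd \<open>y\<close> is its own inverse modulo 4, so \<open>t\<close> is congruent to
  t^(y*y), a power of t^y.\<close>

lemma cong_one_if_odd_power:
  fixes t :: int
  assumes "[t ^ 4 = 1] (mod m)" "[t ^ y = 1] (mod m)" "odd y"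
  shows "[t = 1] (mod m)"
proof -
  obtain c where c: "y = 2 * c + 1" using assms(3) by (elim oddE)
  have "y * y = 4 * (c * c + c) + 1" by (simp add: c algebra_simps)
  then have "t ^ (y * y) = (t ^ 4) ^ (c * c + c) * t"
    by (simp add: power_mult power_add)
  moreover have "[(t ^ 4) ^ (c * c + c) * t = 1 ^ (c * c + c) * t] (mod m)"
    using assms(1) by (intro cong_mult cong_pow) auto
  moreover have "[t ^ (y * y) = 1 ^ y] (mod m)"
    unfolding power_mult using assms(2) by (rule cong_pow)
  ultimately show ?thesis by (metis cong_sym cong_trans power_one mult_1)
qed

lemma sign_cong_imp_eq:
  fixes a b :: int
  assumes "[a = b] (mod m)" "m > 2" "a = 1 \<or> a = -1" "b = 1 \<or> b = -1"
  shows "a = b"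
proof -
  have "m dvd a - b" using assms(1) by (simp add: cong_iff_dvd_diff)
  moreover have "\<bar>a - b\<bar> < m" using assms by auto
  ultimately show ?thesis using dvd_imp_le_int[of "a - b" m] by fastforce
qed

lemma Legendre_cases:
  "\<not> p dvd a \<Longrightarrow> Legendre a p = 1 \<or> Legendre a p = -1"
  by (auto simp: Legendre_def cong_0_iff)

context prime_pair
begin

lemma no_mixed_solutions:
  assumes A: "4 + p ^ y1 = q ^ z1" "odd y1" "odd z1"
    and B: "4 ^ j + p ^ (2 * k) = q ^ z2" "odd z2" "j \<ge> 2" "k > 0"
  shows False
proof -
  have A': "4 + int p ^ y1 = int q ^ z1"
    using arg_cong[OF A(1), of int] by simp
  have B': "4 ^ j + (int p ^ k)\<^sup>2 = int q ^ z2"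
    using arg_cong[OF B(1), of int] by (simp add: power_mult mult.commute flip: power_mult)
  have q2: "q > 2" "int q > 2" using q_ge by auto
  have pq: "p \<noteq> q" using p_mod q_mod by auto

  have "odd j"
  proof -
    have "[int q ^ z1 = 4] (mod int p)"
      unfolding A'[symmetric] using A(2) by (auto simp: cong_def elim!: oddE)
    moreover have "[int q ^ z2 = 4 ^ j] (mod int p)"
      unfolding B'[symmetric] using B(4) by (simp add: cong_iff_dvd_diff power2_eq_square)
    \<comment> \<open>Cross powers express q^(z1 z2) modulo \<open>p\<close> as both 4^z2 and 4^(j
      z1), whose exponents must agree in parity.\<close>
    ultimately have "[(int q ^ z1) ^ z2 = 4 ^ z2] (mod int p)" "[(int q ^ z2) ^ z1 = (4 ^ j) ^ z1] (mod int p)"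
      using cong_pow by blast+
    then have "[4 ^ z2 = 4 ^ (j * z1)] (mod int p)"
      by (metis cong_sym cong_trans power_mult mult.commute)
    then have "even z2 \<longleftrightarrow> even (j * z1)"
      using four_power_cong_imp_parity[OF p p5] by blast
    then show ?thesis using B(2) A(3) by auto
  qed
  then have j3: "j \<ge> 3" using B(3) by (cases "j = 2") auto

  \<comment> \<open>With p = 5 the first equation becomes 4 - 1 = 0 modulo 3, so 3 would divide
    \<open>q\<close>. Excluding 5 makes Fermat's theorem modulo 5 applicable to
    \<open>p\<close>.\<close>
  have p_not_5: "p \<noteq> 5"
  proof
    assume 5: "p = 5"
    have "[(5::int) ^ y1 = (-1) ^ y1] (mod 3)" by (rule cong_pow) (simp add: cong_def)
    then have "[4 + (5::int) ^ y1 = 4 + (-1) ^ y1] (mod 3)" by (rule cong_add[OF cong_refl])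
    then have "3 dvd int q ^ z1" using A' A(2) 5 by (simp add: cong_def dvd_eq_mod_eq_0)
    then have "3 dvd q" using prime_dvd_power[of "3::int" "int q" z1] int_dvd_int_iff[of 3 q] by simp
    then show False using primes_dvd_imp_eq[of 3 q] q q_ge by simp
  qed
  \<comment> \<open>For even \<open>k\<close>, p^(2k) is 1 modulo 5 by Fermat, while 4^j is -1
    because \<open>j\<close> is odd; then 5 would divide \<open>q\<close>.\<close>
  have "odd k"
  proof
    assume "even k"
    then obtain l where l: "k = 2 * l" by (elim evenE)
    have "\<not> 5 dvd p" using primes_dvd_imp_eq[of 5 p] p p_not_5 by auto
    then have "[p ^ (5 - 1) = 1] (mod 5)" by (intro fermat_theorem) auto
    then have "[int p ^ 4 = 1] (mod 5)" by (simp flip: cong_int_iff)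
    then have "[(int p ^ 4) ^ l = 1 ^ l] (mod 5)" by (rule cong_pow)
    moreover have "(int p ^ 4) ^ l = (int p ^ k)\<^sup>2" by (simp add: l flip: power_mult)
    ultimately have "[(int p ^ k)\<^sup>2 = 1] (mod 5)" by simp
    moreover have "[(4::int) ^ j = (-1) ^ j] (mod 5)" by (rule cong_pow) (simp add: cong_def)
    ultimately have "[4 ^ j + (int p ^ k)\<^sup>2 = (-1) ^ j + 1] (mod 5)"
      by (intro cong_add)
    then have "5 dvd int q ^ z2" using B' \<open>odd j\<close> by (simp add: cong_0_iff)
    then have "5 dvd q" using prime_dvd_power[of "5::int" "int q" z2] int_dvd_int_iff[of 5 q] by simp
    then show False using primes_dvd_imp_eq[of 5 q] q q_ge by simp
  qed

  define M where "M = int p ^ k - 2 ^ j"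
  define N where "N = nat \<bar>M\<bar>"
  have intN: "int N = \<bar>M\<bar>" by (simp add: N_def)
  have M2: "M\<^sup>2 = int q ^ z2 - 2 ^ (j + 1) * int p ^ k"
  proof -
    have "(2 ^ j)\<^sup>2 = (4 ^ j :: int)" by (simp add: power2_eq_square flip: power_mult_distrib)
    then show ?thesis unfolding M_def B'[symmetric] by (simp add: power2_diff)
  qed
  \<comment> \<open>8 divides 2^j and \<open>k\<close> is odd. Whatever the sign of
    \<open>M\<close>, its absolute value is then 5 or 3 modulo 8, so (2/N) = -1.\<close>
  have M8: "M mod 8 = 5"
  proof -
    have "(8::int) dvd 2 ^ j" using le_imp_power_dvd[OF j3, of "2::int"] by simp
    moreover have "int p ^ k mod 8 = 5"
      using p_power_mod[of k] \<open>odd k\<close> by (simp flip: of_nat_power of_nat_mod add: zmod_int[of _ 8, simplified, symmetric])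
    ultimately show ?thesis unfolding M_def by (metis diff_zero mod_diff_right_eq dvd_imp_mod_0 mod_mod_trivial)
  qed
  obtain m where m: "M = 8 * m + 5" using M8 by (metis mult_div_mod_eq)
  have "int N = 8 * m + 5 \<or> int N = 8 * (- m - 1) + 3"
    unfolding intN m by (cases "8 * m + 5 < 0") (simp_all add: abs_if)
  then have "int N mod 8 = 5 \<or> int N mod 8 = 3"
  proof
    assume "int N = 8 * (- m - 1) + 3"
    then show ?thesis by (simp only: mod_mult_self4) simp
  qed (simp only: mod_mult_self4, simp)
  then have N8: "N mod 8 = 5 \<or> N mod 8 = 3"
    using of_nat_mod[of N 8, where ?'a = int] by simp linarith
  then have chiN: "chi8 N = -1" by (auto simp: chi8_def)
  have oddN: "odd N" using N8 by presburger
  have qN: "\<not> q dvd N"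
  proof
    assume "q dvd N"
    then have "int q dvd M" by (simp add: N_def)
    then have "int q dvd M\<^sup>2" by (simp add: power2_eq_square)
    moreover have "int q dvd int q ^ z2" using B(2) by (auto elim!: oddE)
    ultimately have "int q dvd int q ^ z2 - M\<^sup>2" by (rule dvd_diff[rotated])
    then have "int q dvd int (2 ^ (j + 1) * p ^ k)" by (simp add: M2)
    then have "q dvd 2 ^ (j + 1) * p ^ k" by (simp only: int_dvd_int_iff)
    then have "q dvd 2 \<or> q dvd p"
      using q by (metis prime_dvd_mult_iff prime_dvd_power)
    then show False
      using pq q2 primes_dvd_imp_eq[OF q p] primes_dvd_imp_eq[OF q two_is_prime_nat] by auto
  qed

  \<comment> \<open>The \<open>v\<close>-th power is the quartic residue character modulo
    \<open>q\<close> and the \<open>2 * v\<close>-th power the quadratic one; \<open>v\<close> is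
    even because q = 1 modulo 8, so signs disappear.\<close>
  define v where "v = (q - 1) div 4"
  obtain s where s: "q = 8 * s + 1" using q_mod by (metis mult_div_mod_eq)
  have v: "(q - 1) div 2 = 2 * v" "q - 1 = 4 * v" "even v" by (auto simp: v_def s)

  \<comment> \<open>Modulo \<open>r\<close> one has p^k = 2^j, hence q^z2 = 2 * 4^j and, as
    \<open>z2\<close> is odd, (q/r) = (2/r). Reciprocity with q = 1 modulo 4 gives (r/q) =
    (2/r).\<close>
  have chi: "[int r ^ (2 * v) = chi8 r] (mod int q)" if r: "prime r" "r dvd N" for r
  proof -
    have r2: "r > 2" using r oddN prime_gt_1_nat[of r] by (cases "r = 2") auto
    have rq: "r \<noteq> q" using r(2) qN by auto
    define w where "w = (r - 1) div 2"
    have "int r dvd M" using r(2) by (simp add: N_def)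
    moreover have "int q ^ z2 - 2 * 4 ^ j = M * (int p ^ k + 2 ^ j)"
      unfolding B'[symmetric] M_def by (simp add: algebra_simps power2_eq_square flip: power_mult_distrib)
    ultimately have "[int q ^ z2 = 2 * 4 ^ j] (mod int r)" by (simp add: cong_iff_dvd_diff)
    then have "[(int q ^ z2) ^ w = (2 * 4 ^ j) ^ w] (mod int r)" by (rule cong_pow)
    moreover have "(int q ^ z2) ^ w = (int q ^ w) ^ z2" by (simp add: mult.commute flip: power_mult)
    moreover have "(2 * 4 ^ j) ^ w = (2::int) ^ w * ((2 ^ w)\<^sup>2) ^ j"
    proof -
      have "(4::int) = 2\<^sup>2" by simp
      then show ?thesis by (simp only: power_mult_distrib power_mult[symmetric]) (simp add: mult_ac)
    qed
    moreover have "[(int q ^ w) ^ z2 = Legendre (int q) (int r) ^ z2] (mod int r)"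
      using euler_criterion[OF r(1) r2, of "int q"] unfolding w_def by (intro cong_pow) (rule cong_sym)
    moreover have "[2 ^ w * ((2 ^ w)\<^sup>2) ^ j = Legendre 2 (int r) * (Legendre 2 (int r) ^ 2) ^ j] (mod int r)"
      using euler_criterion[OF r(1) r2, of 2] unfolding w_def
      by (intro cong_mult cong_pow) (simp_all add: cong_sym_eq)
    ultimately have c: "[Legendre (int q) (int r) ^ z2 = Legendre 2 (int r) * (Legendre 2 (int r) ^ 2) ^ j] (mod int r)"
      by (metis cong_sym cong_trans)
    have L2: "Legendre 2 (int r) = chi8 r" using Legendre_2[OF r(1) r2] by (simp add: chi8_def)
    have chi_sq: "(chi8 r)\<^sup>2 = 1" by (simp add: chi8_def)
    have Lq: "Legendre (int q) (int r) = 1 \<or> Legendre (int q) (int r) = -1"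
      using rq r(1) q by (intro Legendre_cases) (auto simp: primes_dvd_imp_eq)
    then have "Legendre (int q) (int r) ^ z2 = Legendre (int q) (int r)" using B(2) by auto
    then have "[Legendre (int q) (int r) = chi8 r] (mod int r)" using c by (simp add: L2 chi_sq)
    then have Lqr: "Legendre (int q) (int r) = chi8 r"
      by (rule sign_cong_imp_eq) (use r2 Lq in \<open>auto simp: chi8_def\<close>)
    have "Legendre (int r) (int q) * Legendre (int q) (int r) = 1"
      using Quadratic_Reciprocity[OF r(1) r2 q q2(1) rq] v(1) by simp
    then have "Legendre (int r) (int q) = chi8 r"
      unfolding Lqr by (auto simp: chi8_def split: if_splits)
    then show ?thesis using euler_criterion[OF q q2(1), of "int r"] v(1) by (simp add: cong_sym_eq)
  qed
  have m1: "[int N ^ (2 * v) = -1] (mod int q)"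
    using power_cong_chi8[OF oddN chi] chiN by simp

  have two: "[2 ^ (2 * v) = 1] (mod int q)"
    using euler_criterion[OF q q2(1), of 2] Legendre_2[OF q q2(1)] q_mod v(1) by (simp add: cong_sym_eq)
  \<comment> \<open>The first equation gives p^y1 = -4 modulo \<open>q\<close>, and (-4)^v = 2^(2v)
    = 1; the odd exponent \<open>y1\<close> can then be removed.\<close>
  have p1: "[int p ^ v = 1] (mod int q)"
  proof (rule cong_one_if_odd_power[OF _ _ A(2)])
    have "[p ^ (q - 1) = 1] (mod q)"
      using p q pq primes_dvd_imp_eq[OF q p] by (intro fermat_theorem) auto
    then show "[(int p ^ v) ^ 4 = 1] (mod int q)"
      unfolding v(2) by (simp add: mult.commute flip: cong_int_iff power_mult)
    have "int q dvd int q ^ z1" using A(3) by (auto elim!: oddE)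
    then have "int q dvd int p ^ y1 - (-4)" unfolding A'[symmetric] by (simp add: add.commute)
    then have "[int p ^ y1 = -4] (mod int q)" by (simp only: cong_iff_dvd_diff)
    then have "[(int p ^ y1) ^ v = (-4) ^ v] (mod int q)" by (rule cong_pow)
    moreover have "(-4) ^ v = (2::int) ^ (2 * v)" using v(3) by (simp add: power_mult)
    ultimately show "[(int p ^ v) ^ y1 = 1] (mod int q)"
      using two by (metis cong_trans power_mult mult.commute)
  qed
  \<comment> \<open>Since \<open>j + 1\<close> is even, the factor 2^(j+1) contributes only powers
    of 2^(2v) = 1. So N^(2v) = M^(2v) is 1 modulo \<open>q\<close>, against
    \<open>m1\<close>.\<close>
  obtain i where i: "j + 1 = 2 * i" using \<open>odd j\<close> by (metis evenE odd_add odd_one)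
  have "int q dvd int q ^ z2" using B(2) by (auto elim!: oddE)
  then have "[M\<^sup>2 = - (2 ^ (j + 1) * int p ^ k)] (mod int q)"
    unfolding M2 by (simp add: cong_iff_dvd_diff)
  then have "[(M\<^sup>2) ^ v = (- (2 ^ (j + 1) * int p ^ k)) ^ v] (mod int q)" by (rule cong_pow)
  also have "(- (2 ^ (j + 1) * int p ^ k)) ^ v = (2 ^ (2 * v)) ^ i * (int p ^ v) ^ k"
  proof -
    have "(- (2 ^ (j + 1) * int p ^ k)) ^ v = (2 ^ (2 * i) * int p ^ k) ^ v"
      unfolding i using v(3) by simp
    then show ?thesis by (simp add: power_mult_distrib mult_ac flip: power_mult)
  qed
  also have "[(2 ^ (2 * v)) ^ i * (int p ^ v) ^ k = 1 ^ i * 1 ^ k] (mod int q)"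
    using two p1 by (intro cong_mult cong_pow)
  finally have "[(M\<^sup>2) ^ v = 1] (mod int q)" by simp
  moreover have "int N ^ (2 * v) = (M\<^sup>2) ^ v" by (simp add: intN power_mult)
  ultimately have "[-1 = 1] (mod int q)" using m1 by (metis cong_sym cong_trans)
  then show False using sign_cong_imp_eq[of "-1" 1 "int q"] q2(2) by simp
qed

end

section \<open>Odd powers of binomials\<close>

text \<open>For s = x^2, t = y^2 and n = 2m + 1, this is the cofactor of x in the part of (x + y)^n
  that is odd in x. Taking squares as arguments keeps it integral when y is an integer multiple of
  the square root of -D; the ring is generic because both integers and complex numbers
  occur.\<close>

definition odd_binom :: "nat \<Rightarrow> 'a \<Rightarrow> 'a \<Rightarrow> 'a :: comm_ring_1" where
  "odd_binom m s t = (\<Sum>i\<le>m. of_nat (2 * m + 1 choose (2 * i + 1)) * s ^ i * t ^ (m - i))"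

lemma sum_atMost_odd_split:
  fixes f :: "nat \<Rightarrow> 'a :: comm_monoid_add"
  shows "(\<Sum>k\<le>2 * m + 1. f k) = (\<Sum>i\<le>m. f (2 * i)) + (\<Sum>i\<le>m. f (2 * i + 1))"
  by (induction m) (simp_all add: algebra_simps)

text \<open>Terms with odd power of \<open>x\<close> give the first summand. As the exponent is odd,
  the others are odd in \<open>y\<close>, and the reindexing i -> m - i shows the same polynomial
  with exchanged arguments.\<close>

lemma binomial_odd_power:
  fixes x y :: "'a :: comm_ring_1"
  shows "(x + y) ^ (2 * m + 1) = x * odd_binom m (x\<^sup>2) (y\<^sup>2) + y * odd_binom m (y\<^sup>2) (x\<^sup>2)"
proof -
  let ?f = "\<lambda>k. of_nat (2 * m + 1 choose k) * x ^ k * y ^ (2 * m + 1 - k)"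
  have "(x + y) ^ (2 * m + 1) = (\<Sum>i\<le>m. ?f (2 * i)) + (\<Sum>i\<le>m. ?f (2 * i + 1))"
    unfolding binomial_ring by (rule sum_atMost_odd_split)
  also have "(\<Sum>i\<le>m. ?f (2 * i + 1)) = x * odd_binom m (x\<^sup>2) (y\<^sup>2)"
    unfolding odd_binom_def sum_distrib_left
  proof (rule sum.cong[OF refl])
    fix i assume "i \<in> {..m}"
    then have "2 * m + 1 - (2 * i + 1) = 2 * (m - i)" by simp
    then show "?f (2 * i + 1) = x * (of_nat (2 * m + 1 choose (2 * i + 1)) * (x\<^sup>2) ^ i * (y\<^sup>2) ^ (m - i))"
      by (simp only: power_mult[symmetric] power_add) (simp add: mult_ac)
  qed
  also have "(\<Sum>i\<le>m. ?f (2 * i)) = (\<Sum>i\<le>m. ?f (2 * (m - i)))"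
    by (rule sum.reindex_bij_witness[of _ "\<lambda>i. m - i" "\<lambda>i. m - i"]) auto
  also have "\<dots> = y * odd_binom m (y\<^sup>2) (x\<^sup>2)"
    unfolding odd_binom_def sum_distrib_left
  proof (rule sum.cong[OF refl])
    fix i assume "i \<in> {..m}"
    then have "i \<le> m" by simp
    then have "2 * m + 1 - 2 * (m - i) = 2 * i + 1"
      "2 * m + 1 choose (2 * (m - i)) = 2 * m + 1 choose (2 * i + 1)"
      using binomial_symmetric[of "2 * i + 1" "2 * m + 1"] by (auto simp: diff_mult_distrib2)
    then show "?f (2 * (m - i)) = y * (of_nat (2 * m + 1 choose (2 * i + 1)) * (y\<^sup>2) ^ i * (x\<^sup>2) ^ (m - i))"
      by (simp only: power_mult[symmetric] power_add) (simp add: mult_ac)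
  qed
  finally show ?thesis by (simp add: add.commute)
qed

lemma of_int_odd_binom: "of_int (odd_binom m s t) = odd_binom m (of_int s) (of_int t)"
  by (simp add: odd_binom_def)

lemma odd_binom_cong: "[odd_binom m s t = of_nat (2 * m + 1) * t ^ m] (mod s)" for s t :: int
proof -
  have "odd_binom m s t = of_nat (2 * m + 1) * t ^ m
      + (\<Sum>i<m. of_nat (2 * m + 1 choose (2 * Suc i + 1)) * s ^ Suc i * t ^ (m - Suc i))"
    unfolding odd_binom_def by (subst sum.atMost_shift) simp
  moreover have "s dvd (\<Sum>i<m. of_nat (2 * m + 1 choose (2 * Suc i + 1)) * s ^ Suc i * t ^ (m - Suc i))"
    by (rule dvd_sum) (simp add: dvd_mult dvd_mult2)
  ultimately show ?thesis by (simp add: cong_iff_dvd_diff)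
qed

text \<open>
  Writing \<open>n = 2 * m + 1\<close>, the identity \<open>(2i+1) C(n, 2i+1) = n C(n-1, 2i)\<close> shows that the \<open>i\<close>-th summand,
  for \<open>i > 0\<close>, contains \<open>p\<close> to a higher power than \<open>n\<close>; \<open>p \<ge> 5\<close> ensures \<open>p^i\<close> does not divide \<open>2i+1\<close>.
\<close>

lemma odd_binom_lte:
  fixes s t :: int
  assumes p: "prime p" "p \<ge> 5" and s: "int p dvd s" and t: "\<not> int p dvd t"
    and e: "int p ^ e dvd odd_binom m s t"
  shows "p ^ e dvd 2 * m + 1"
proof (rule ccontr)
  assume n: "\<not> p ^ e dvd 2 * m + 1"
  define f where "f = multiplicity p (2 * m + 1)"
  have f: "p ^ f dvd 2 * m + 1" unfolding f_def by (rule multiplicity_dvd)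
  have f': "\<not> p ^ Suc f dvd 2 * m + 1"
  proof
    assume "p ^ Suc f dvd 2 * m + 1"
    then have "Suc f \<le> multiplicity p (2 * m + 1)" using p by (intro multiplicity_geI) auto
    then show False by (simp add: f_def)
  qed
  have "f < e" using n f by (meson dvd_trans le_imp_power_dvd not_le)
  then have "int p ^ Suc f dvd int p ^ e" by (intro le_imp_power_dvd) simp
  \<comment> \<open>Here p^f is the exact power of \<open>p\<close> in 2m + 1. If p^(f+1) divides
    the whole sum and every summand except the first, it divides (2m + 1) t^m, a
    contradiction.\<close>
  then have d1: "int p ^ Suc f dvd odd_binom m s t" using e by (rule dvd_trans)
  have d0: "int p ^ Suc f dvd of_nat (2 * m + 1 choose (2 * Suc i + 1)) * s ^ Suc i" for i
  proof -
    define v where "v = multiplicity p (2 * Suc i + 1)"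
    obtain w where w: "2 * Suc i + 1 = p ^ v * w" "\<not> p dvd w"
      using multiplicity_decompose'[of "2 * Suc i + 1" p] p unfolding v_def by auto
    \<comment> \<open>The summand index is \<open>Suc i\<close>, so s^(Suc i) supplies one more
      factor \<open>p\<close> than the denominator \<open>2 * Suc i + 1\<close> can cancel.\<close>
    have "v \<le> i"
    proof (rule ccontr)
      assume "\<not> v \<le> i"
      have "5 ^ Suc i \<le> (5::nat) ^ v" using \<open>\<not> v \<le> i\<close> by (intro power_increasing) auto
      also have "\<dots> \<le> p ^ v" using p by (intro power_mono) auto
      also have "\<dots> \<le> 2 * Suc i + 1" using w by (cases w) auto
      finally have "5 ^ Suc i \<le> 2 * Suc i + 1" .
      moreover have "2 * Suc i + 1 < 5 ^ Suc i" by (induction i) auto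
      ultimately show False by simp
    qed
    have "p ^ f dvd p ^ v * w * (2 * m + 1 choose (2 * Suc i + 1))"
      using f binomial_absorption[of "2 * Suc i" "2 * m + 1"] unfolding w(1)[symmetric]
      by (metis Suc_eq_plus1 dvd_mult2)
    moreover have "coprime (p ^ f) w" using p w(2) by (simp add: prime_imp_coprime)
    ultimately have "p ^ f dvd p ^ v * (2 * m + 1 choose (2 * Suc i + 1))"
      by (metis coprime_dvd_mult_left_iff mult.assoc mult.commute)
    then have "p ^ Suc f dvd p ^ Suc v * (2 * m + 1 choose (2 * Suc i + 1))"
      by (simp add: mult.assoc mult_dvd_mono)
    also have "\<dots> dvd p ^ Suc i * (2 * m + 1 choose (2 * Suc i + 1))"
      using \<open>v \<le> i\<close> by (intro mult_dvd_mono le_imp_power_dvd) auto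
    finally have "int (p ^ Suc f) dvd int (p ^ Suc i * (2 * m + 1 choose (2 * Suc i + 1)))"
      by (simp only: int_dvd_int_iff)
    also have "\<dots> dvd s ^ Suc i * int (2 * m + 1 choose (2 * Suc i + 1))"
      using s by (simp only: of_nat_mult of_nat_power) (intro mult_dvd_mono dvd_power_same, auto)
    finally show ?thesis by (simp only: of_nat_power mult.commute)
  qed
  define S where "S = (\<Sum>i<m. of_nat (2 * m + 1 choose (2 * Suc i + 1)) * s ^ Suc i * t ^ (m - Suc i))"
  have d2: "int p ^ Suc f dvd S"
    unfolding S_def by (intro dvd_sum dvd_mult2 d0)
  have "odd_binom m s t = of_nat (2 * m + 1) * t ^ m + S"
    unfolding odd_binom_def S_def by (subst sum.atMost_shift) simp
  then have "int (2 * m + 1) * t ^ m = odd_binom m s t - S" by simp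
  then have "int p ^ Suc f dvd int (2 * m + 1) * t ^ m"
    using dvd_diff[OF d1 d2] by (simp only:)
  moreover have "coprime (int p ^ Suc f) (t ^ m)"
    using p t by (simp add: prime_imp_coprime)
  ultimately have "int p ^ Suc f dvd int (2 * m + 1)"
    by (metis coprime_dvd_mult_left_iff)
  then have "p ^ Suc f dvd 2 * m + 1" by (simp only: int_dvd_int_iff flip: of_nat_power)
  then show False using f' by simp
qed

text \<open>
  The same argument with the prime \<open>2\<close> and \<open>2i (2i+1) C(n, 2i+1) = n (n-1) C(n-2, 2i-1)\<close>: all summands
  with \<open>i > 0\<close> contain \<open>2\<close> to a higher power than \<open>n - 1\<close>.
\<close>

lemma odd_binom_eq_one:
  fixes s :: int
  assumes s: "4 dvd s" and eq: "odd_binom m s 1 = 1"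
  shows "m = 0"
proof (rule ccontr)
  assume "m \<noteq> 0"
  define f where "f = multiplicity 2 (2 * m)"
  have f: "2 ^ f dvd 2 * m" unfolding f_def by (rule multiplicity_dvd)
  have f': "\<not> 2 ^ Suc f dvd 2 * m"
  proof
    assume "2 ^ Suc f dvd 2 * m"
    then have "Suc f \<le> multiplicity 2 (2 * m)" using \<open>m \<noteq> 0\<close> by (intro multiplicity_geI) auto
    then show False by (simp add: f_def)
  qed
  have d0: "2 ^ Suc f dvd of_nat (2 * m + 1 choose (2 * Suc i + 1)) * s ^ Suc i" for i
  proof -
    let ?C = "2 * m + 1 choose (2 * Suc i + 1)"
    define v where "v = multiplicity 2 (2 * Suc i)"
    obtain w where w: "2 * Suc i = 2 ^ v * w" "\<not> 2 dvd w"
      using multiplicity_decompose'[of "2 * Suc i" 2] unfolding v_def by auto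
    \<comment> \<open>4^(Suc i) has 2-adic exponent \<open>2 * Suc i\<close>, which thus exceeds
      what the denominator cancels by at least one.\<close>
    have "v < 2 * Suc i"
    proof -
      have "v < 2 ^ v" by simp
      also have "\<dots> \<le> 2 * Suc i" using w by (cases w) auto
      finally show ?thesis .
    qed
    have e: "2 * m + 1 - 1 = 2 * m" "2 * Suc i + 1 - 1 = 2 * Suc i" "2 * Suc i - 1 = 2 * i + 1"
      by simp_all
    have e1: "(2 * Suc i + 1) * ?C = (2 * m + 1) * (2 * m choose (2 * Suc i))"
      by (subst times_binomial_minus1_eq) (simp, simp only: e)
    have e2: "2 * Suc i * (2 * m choose (2 * Suc i)) = 2 * m * (2 * m - 1 choose (2 * i + 1))"
      by (subst times_binomial_minus1_eq) (simp, simp only: e)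
    have "(2 * Suc i + 1) * (2 * Suc i * ?C) = (2 * m + 1) * (2 * Suc i * (2 * m choose (2 * Suc i)))"
      unfolding mult.left_commute[of _ "2 * Suc i"] e1 ..
    also have "\<dots> = 2 * m * ((2 * m + 1) * (2 * m - 1 choose (2 * i + 1)))"
      unfolding e2 by (rule mult.left_commute)
    finally have e3: "(2 * Suc i + 1) * (2 * Suc i * ?C) = \<dots>" .
    have "2 ^ f dvd (2 * Suc i + 1) * (2 ^ v * w * ?C)"
      unfolding w(1)[symmetric] e3 using f by (rule dvd_mult2)
    then have "2 ^ f dvd ((2 * Suc i + 1) * w) * (2 ^ v * ?C)" by (simp only: mult_ac)
    moreover have "coprime (2 ^ f) ((2 * Suc i + 1) * w)" using w(2) by simp
    ultimately have "2 ^ f dvd 2 ^ v * ?C" by (simp only: coprime_dvd_mult_right_iff)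
    then have "2 ^ Suc f dvd 2 ^ Suc v * ?C" by (simp add: mult.assoc)
    also have "\<dots> dvd 2 ^ (2 * Suc i) * ?C"
      using \<open>v < 2 * Suc i\<close> by (intro mult_dvd_mono le_imp_power_dvd) auto
    also have "\<dots> = 4 ^ Suc i * ?C" by (simp only: power_mult) simp
    finally have "int (2 ^ Suc f) dvd int (4 ^ Suc i * ?C)" by (simp only: int_dvd_int_iff)
    also have "\<dots> dvd s ^ Suc i * int ?C"
      using s by (simp only: of_nat_mult of_nat_power) (intro mult_dvd_mono dvd_power_same, auto)
    finally show ?thesis by (simp only: of_nat_power mult.commute of_nat_numeral)
  qed
  define S where "S = (\<Sum>i<m. of_nat (2 * m + 1 choose (2 * Suc i + 1)) * s ^ Suc i * 1 ^ (m - Suc i))"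
  have d: "2 ^ Suc f dvd S"
    unfolding S_def by (intro dvd_sum dvd_mult2 d0)
  have "odd_binom m s 1 = of_nat (2 * m + 1) * 1 ^ m + S"
    unfolding odd_binom_def S_def by (subst sum.atMost_shift) simp
  \<comment> \<open>The first summand is 2m + 1, so the value 1 forces the remaining ones to sum to
    -2m, contradicting the choice of \<open>f\<close>.\<close>
  then have "int (2 * m) = - S"
    using eq by simp
  then have "2 ^ Suc f dvd int (2 * m)" using d by (metis dvd_minus_iff)
  then have "2 ^ Suc f dvd 2 * m" by (metis int_dvd_int_iff of_nat_numeral of_nat_power)
  then show False using f' by simp
qed

section \<open>Primitive representations of prime powers by \<open>a\<^sup>2 + D b\<^sup>2\<close>\<close>

text \<open>The element a + b sqrt(-D), placed inside the complex numbers so that ring laws,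
  conjugation and the binomial theorem are inherited.\<close>

definition qi :: "int \<Rightarrow> int \<Rightarrow> int \<Rightarrow> complex" where
  "qi D a b = Complex (of_int a) (of_int b * sqrt (of_int D))"

lemma qi_eq_iff: "D > 0 \<Longrightarrow> qi D a b = qi D c d \<longleftrightarrow> a = c \<and> b = d"
  by (simp add: qi_def)

lemma qi_mult: "D > 0 \<Longrightarrow> qi D a b * qi D c d = qi D (a * c - D * b * d) (a * d + b * c)"
  by (simp add: qi_def complex_eq_iff algebra_simps)

lemma qi_of_int: "qi D a 0 = of_int a"
  by (simp add: qi_def complex_eq_iff)

lemma qi_cnj: "cnj (qi D a b) = qi D a (- b)"
  by (simp add: qi_def complex_eq_iff)

lemma qi_norm: "D > 0 \<Longrightarrow> qi D a b * qi D a (- b) = of_int (a\<^sup>2 + D * b\<^sup>2)"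
  by (simp add: qi_mult power2_eq_square qi_of_int)

lemma qi_power_ex: "D > 0 \<Longrightarrow> \<exists>c d. qi D a b ^ n = qi D c d"
proof (induction n)
  case 0
  show ?case using qi_of_int[of D 1] by (metis of_int_1 power_0)
next
  case (Suc n)
  then show ?case by (metis power_Suc qi_mult)
qed

lemma norm_mult_int:
  "(a * c - D * b * d)\<^sup>2 + D * (a * d + b * c)\<^sup>2 = (a\<^sup>2 + D * b\<^sup>2) * (c\<^sup>2 + D * d\<^sup>2)" for a b c d D :: int
  by (simp add: power2_eq_square algebra_simps)

text \<open>The square of the imaginary summand is the integer -D d^2, so both cofactors are
  integers. In particular \<open>c\<close> and \<open>d\<close> divide the respective coordinates of
  the power.\<close>

lemma qi_odd_power:
  assumes "D > 0"
  shows "qi D c d ^ (2 * m + 1) = qi D (c * odd_binom m (c\<^sup>2) (- D * d\<^sup>2)) (d * odd_binom m (- D * d\<^sup>2) (c\<^sup>2))"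
proof -
  define x y where "x = complex_of_int c" and "y = \<i> * complex_of_real (of_int d * sqrt (of_int D))"
  have "qi D c d = x + y" by (simp add: qi_def x_def y_def complex_eq_iff)
  moreover have "x\<^sup>2 = of_int (c\<^sup>2)" by (simp add: x_def)
  moreover have "y\<^sup>2 = of_int (- D * d\<^sup>2)"
  proof -
    have "y\<^sup>2 = - complex_of_real ((of_int d * sqrt (of_int D))\<^sup>2)"
      by (simp add: y_def power_mult_distrib)
    also have "(of_int d * sqrt (of_int D))\<^sup>2 = real_of_int (D * d\<^sup>2)"
      using assms by (simp add: power_mult_distrib)
    finally show ?thesis by simp
  qed
  ultimately have "qi D c d ^ (2 * m + 1)
      = x * of_int (odd_binom m (c\<^sup>2) (- D * d\<^sup>2)) + y * of_int (odd_binom m (- D * d\<^sup>2) (c\<^sup>2))"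
    by (simp only: binomial_odd_power of_int_odd_binom)
  also have "\<dots> = qi D (c * odd_binom m (c\<^sup>2) (- D * d\<^sup>2)) (d * odd_binom m (- D * d\<^sup>2) (c\<^sup>2))"
    by (simp add: qi_def x_def y_def complex_eq_iff)
  finally show ?thesis .
qed

definition prim_rep :: "int \<Rightarrow> nat \<Rightarrow> nat \<Rightarrow> int \<Rightarrow> int \<Rightarrow> bool" where
  "prim_rep D q n a b \<longleftrightarrow> coprime a b \<and> a\<^sup>2 + D * b\<^sup>2 = int q ^ n"

lemma prim_rep_minus: "prim_rep D q n a (- b) \<longleftrightarrow> prim_rep D q n a b"
  by (simp add: prim_rep_def)

lemma prim_rep_not_dvd:
  assumes "prime q" "\<not> int q dvd D" "prim_rep D q n a b" "n > 0"
  shows "\<not> int q dvd a" "\<not> int q dvd b"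
proof -
  have pr: "prime (int q)" using assms(1) by simp
  have s: "a\<^sup>2 + D * b\<^sup>2 = int q ^ n" and c: "coprime a b" using assms(3) by (auto simp: prim_rep_def)
  have dv: "int q dvd a\<^sup>2 + D * b\<^sup>2" unfolding s using assms(4) by simp
  have "int q dvd a \<longleftrightarrow> int q dvd b"
  proof
    assume "int q dvd a"
    then have "int q dvd a\<^sup>2" by (simp add: power2_eq_square)
    then have "int q dvd D * b\<^sup>2" using dv by (simp add: dvd_add_right_iff)
    then show "int q dvd b" using pr assms(2) by (auto simp: prime_dvd_mult_iff prime_dvd_power_iff)
  next
    assume "int q dvd b"
    then have "int q dvd D * b\<^sup>2" by (simp add: power2_eq_square)
    then have "int q dvd a\<^sup>2" using dv by (simp add: dvd_add_left_iff)
    then show "int q dvd a" using pr by (auto simp: prime_dvd_power_iff)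
  qed
  moreover have "\<not> (int q dvd a \<and> int q dvd b)"
    using c pr by (metis coprime_common_divisor not_prime_unit)
  ultimately show "\<not> int q dvd a" "\<not> int q dvd b" by auto
qed

text \<open>The quotient is (a + b sqrt(-D))(c - d sqrt(-D)) / q^n. The hypothesis makes its second
  coordinate integral, and the norm identity then forces q^(2n) to divide the square of
  \<open>a * c + D * b * d\<close>.\<close>

lemma prim_rep_div_aux:
  assumes D: "D > 0" and q: "prime q"
    and r1: "prim_rep D q m a b" and r2: "prim_rep D q n c d" and "n \<le> m"
    and dvd: "int q ^ n dvd a * d - b * c"
  shows "\<exists>e f. prim_rep D q (m - n) e f \<and> qi D a b = qi D c d * qi D e f"
proof -
  define Q where "Q = int q ^ n"
  have Q0: "Q > 0" using q by (simp add: Q_def prime_gt_0_nat)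
  have na: "a\<^sup>2 + D * b\<^sup>2 = int q ^ m" and nc: "c\<^sup>2 + D * d\<^sup>2 = Q"
    using r1 r2 by (auto simp: prim_rep_def Q_def)
  obtain f where f: "b * c - a * d = Q * f"
    using dvd unfolding Q_def by (metis dvd_def dvd_minus_iff minus_diff_eq)
  have "(a * c + D * b * d)\<^sup>2 + D * (b * c - a * d)\<^sup>2 = int q ^ m * Q"
    using norm_mult_int[of a c D b "- d"] na nc by simp
  then have "(a * c + D * b * d)\<^sup>2 = int q ^ m * Q - D * (Q * f)\<^sup>2" unfolding f by simp
  also have "int q ^ m = Q * int q ^ (m - n)" using \<open>n \<le> m\<close> by (simp add: Q_def flip: power_add)
  finally have "(a * c + D * b * d)\<^sup>2 = Q\<^sup>2 * (int q ^ (m - n) - D * f\<^sup>2)"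
    by (simp add: power2_eq_square algebra_simps)
  then have "Q\<^sup>2 dvd (a * c + D * b * d)\<^sup>2" by simp
  then have "Q dvd a * c + D * b * d" by simp
  then obtain e where e: "a * c + D * b * d = Q * e" by (elim dvdE)
  have "Q * a = Q * (c * e - D * d * f)"
  proof -
    have "Q * (c * e - D * d * f) = c * (Q * e) - D * d * (Q * f)" by (simp add: algebra_simps)
    also have "\<dots> = a * (c\<^sup>2 + D * d\<^sup>2)" unfolding e[symmetric] f[symmetric]
      by (simp add: algebra_simps power2_eq_square)
    finally show ?thesis unfolding nc by (metis mult.commute)
  qed
  then have a: "a = c * e - D * d * f" using Q0 by simp
  have "Q * b = Q * (c * f + d * e)"
  proof -
    have "Q * (c * f + d * e) = c * (Q * f) + d * (Q * e)" by (simp add: algebra_simps)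
    also have "\<dots> = b * (c\<^sup>2 + D * d\<^sup>2)" unfolding e[symmetric] f[symmetric]
      by (simp add: algebra_simps power2_eq_square)
    finally show ?thesis unfolding nc by (metis mult.commute)
  qed
  then have b: "b = c * f + d * e" using Q0 by simp
  have "int q ^ m = Q * (e\<^sup>2 + D * f\<^sup>2)"
    using norm_mult_int[of c e D d f] by (simp add: a[symmetric] b[symmetric] na nc)
  moreover have "int q ^ m = Q * int q ^ (m - n)" using \<open>n \<le> m\<close> by (simp add: Q_def flip: power_add)
  ultimately have "e\<^sup>2 + D * f\<^sup>2 = int q ^ (m - n)" using Q0 by simp
  moreover have "coprime e f"
  proof (rule coprimeI)
    fix g assume "g dvd e" "g dvd f"
    then have "g dvd a" "g dvd b" unfolding a b by simp_all
    then show "is_unit g" using r1 coprime_common_divisor[of a b g] by (simp add: prim_rep_def)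
  qed
  moreover have "qi D a b = qi D c d * qi D e f"
    using D by (simp add: qi_mult a b algebra_simps)
  ultimately show ?thesis by (auto simp: prim_rep_def)
qed

text \<open>This stands in for ideal factorization. The product of ad - bc and ad + bc is divisible
  by q^n, but \<open>q\<close> cannot divide both, since it would divide 2ad; so q^n divides one of
  them. The two outcomes are division by an element or by its conjugate.\<close>

lemma prim_rep_div:
  assumes D: "D > 0" "\<not> int q dvd D" and q: "prime q" "odd q"
    and r1: "prim_rep D q m a b" and r2: "prim_rep D q n c d" and nm: "n \<le> m"
  obtains e f where "prim_rep D q (m - n) e f" "qi D a b = qi D c d * qi D e f"
  | e f where "prim_rep D q (m - n) e f" "qi D a b = qi D c (- d) * qi D e f"
proof (cases "n = 0")
  case True
  then show ?thesis using prim_rep_div_aux[OF D(1) q(1) r1 r2 nm] that(1) by auto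
next
  case False
  have pr: "prime (int q)" using q by simp
  have na: "a\<^sup>2 = int q ^ m - D * b\<^sup>2" and nc: "c\<^sup>2 = int q ^ n - D * d\<^sup>2"
    using r1 r2 by (auto simp: prim_rep_def)
  have "(a * d - b * c) * (a * d + b * c) = a\<^sup>2 * d\<^sup>2 - b\<^sup>2 * c\<^sup>2"
    by (simp add: power2_eq_square algebra_simps)
  also have "\<dots> = int q ^ m * d\<^sup>2 - int q ^ n * b\<^sup>2"
    unfolding na nc by (simp add: algebra_simps)
  finally have prod: "int q ^ n dvd (a * d - b * c) * (a * d + b * c)"
    using le_imp_power_dvd[OF nm, of "int q"] by simp
  have "\<not> (int q dvd a * d - b * c \<and> int q dvd a * d + b * c)"
  proof
    assume "int q dvd a * d - b * c \<and> int q dvd a * d + b * c"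
    then have "int q dvd (a * d - b * c) + (a * d + b * c)" by (elim conjE dvd_add)
    then have "int q dvd 2 * (a * d)" by simp
    moreover have "\<not> int q dvd 2"
      using q primes_dvd_imp_eq[OF q(1) two_is_prime_nat] int_dvd_int_iff[of q 2] by auto
    ultimately have "int q dvd a \<or> int q dvd d" using pr by (auto simp: prime_dvd_mult_iff)
    then show False
      using prim_rep_not_dvd[OF q(1) D(2) r1] prim_rep_not_dvd[OF q(1) D(2) r2] False nm by auto
  qed
  then consider "coprime (int q ^ n) (a * d + b * c)" | "coprime (int q ^ n) (a * d - b * c)"
    using pr by (auto simp: prime_imp_coprime)
  then show ?thesis
  proof cases
    case 1
    then have "int q ^ n dvd a * d - b * c" using prod by (simp add: coprime_dvd_mult_left_iff)
    then show ?thesis using prim_rep_div_aux[OF D(1) q(1) r1 r2 nm] that(1) by auto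
  next
    case 2
    then have "int q ^ n dvd a * d + b * c" using prod by (simp add: coprime_dvd_mult_right_iff)
    then have "int q ^ n dvd a * (- d) - b * c" by (metis dvd_minus_iff minus_add_distrib mult_minus_right uminus_add_conv_diff add.inverse_inverse diff_minus_eq_add minus_diff_eq add.commute)
    then show ?thesis
      using prim_rep_div_aux[OF D(1) q(1) r1 prim_rep_minus[THEN iffD2, OF r2] nm] that(2) by auto
  qed
qed

lemma prim_rep_0:
  assumes "D > 0" "prim_rep D q 0 a b"
  shows "\<bar>a\<bar> = 1 \<and> b = 0 \<or> D = 1 \<and> a = 0 \<and> \<bar>b\<bar> = 1"
proof -
  have s: "a\<^sup>2 + D * b\<^sup>2 = 1" using assms(2) by (simp add: prim_rep_def)
  show ?thesis
  proof (cases "b = 0")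
    case True
    then show ?thesis using s by (auto simp: power2_eq_1_iff)
  next
    case False
    then have "b\<^sup>2 \<ge> 1" by (simp add: int_one_le_iff_zero_less)
    then have "1 * 1 \<le> D * b\<^sup>2" using assms(1) by (intro mult_mono) auto
    then have "a\<^sup>2 \<le> 0" "D * b\<^sup>2 = 1" using s zero_le_power2[of a] by linarith+
    then show ?thesis using assms(1) by (auto simp: zmult_eq_1_iff power2_eq_1_iff)
  qed
qed

text \<open>The elements of norm 1 are 1 and -1, joined by i and -i when D = 1.\<close>

lemma prim_rep_0_power4:
  assumes "D > 0" "prim_rep D q 0 a b"
  shows "qi D a b ^ 4 = 1"
proof -
  have "qi D a b ^ 4 = (qi D a b * qi D a b) * (qi D a b * qi D a b)" by (simp add: eval_nat_numeral)
  also have "\<dots> = qi D 1 0"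
    using prim_rep_0[OF assms] assms(1) by (auto simp: qi_mult abs_if qi_eq_iff split: if_splits)
  finally show ?thesis by (simp add: qi_of_int)
qed

text \<open>The quotient by the second element or its conjugate has norm 1; the swapped alternative
  comes from the units i and -i.\<close>

lemma prim_rep_norm_unique:
  assumes D: "D > 0" "\<not> int q dvd D" and q: "prime q" "odd q"
    and r: "prim_rep D q n a b" "prim_rep D q n c d"
  shows "\<bar>a\<bar> = \<bar>c\<bar> \<and> \<bar>b\<bar> = \<bar>d\<bar> \<or> D = 1 \<and> \<bar>a\<bar> = \<bar>d\<bar> \<and> \<bar>b\<bar> = \<bar>c\<bar>"
  using D q r order.refl
proof (cases rule: prim_rep_div)
  case (1 e f)
  then show ?thesis using prim_rep_0[of D q e f] D(1) by (auto simp: qi_mult qi_eq_iff abs_mult)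
next
  case (2 e f)
  then show ?thesis using prim_rep_0[of D q e f] D(1) by (auto simp: qi_mult qi_eq_iff abs_mult)
qed

lemma qi_mult_of_int: "D > 0 \<Longrightarrow> of_int k * qi D a b = qi D (k * a) (k * b)"
  by (simp add: qi_mult flip: qi_of_int[of D])

text \<open>Induction on \<open>z\<close>, splitting off the generator or its conjugate; by
  minimality of \<open>h\<close> the process can only stop at norm 1. The condition on
  \<open>d'\<close> leaves the choice of conjugate open.\<close>

lemma prim_rep_generator:
  assumes D: "D > 0" "\<not> int q dvd D" and q: "prime q" "odd q"
    and h: "h > 0" and g: "prim_rep D q h c d"
    and least: "\<And>n a b. 0 < n \<Longrightarrow> n < h \<Longrightarrow> \<not> prim_rep D q n a b"
    and r: "prim_rep D q z a b"
  shows "\<exists>n e f d'. z = h * n \<and> d'\<^sup>2 = d\<^sup>2 \<and> prim_rep D q 0 e f \<and> qi D a b = qi D e f * qi D c d' ^ n"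
  using r
proof (induction z arbitrary: a b rule: less_induct)
  case (less z)
  consider "z = 0" | "0 < z" "z < h" | "h \<le> z" by linarith
  then show ?case
  proof cases
    case 1
    then show ?thesis using less.prems by (intro exI[of _ 0] exI[of _ a] exI[of _ b] exI[of _ d]) auto
  next
    case 2
    then show ?thesis using least less.prems by blast
  next
    case 3
    have "\<exists>d1 e f. d1\<^sup>2 = d\<^sup>2 \<and> prim_rep D q (z - h) e f \<and> qi D a b = qi D c d1 * qi D e f"
      using D q less.prems g 3
    proof (cases rule: prim_rep_div)
      case (1 e f)
      then show ?thesis by blast
    next
      case (2 e f)
      then show ?thesis by (intro exI[of _ "- d"] exI[of _ e] exI[of _ f]) auto
    qed
    then obtain d1 e f where 1: "d1\<^sup>2 = d\<^sup>2" "prim_rep D q (z - h) e f" "qi D a b = qi D c d1 * qi D e f"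
      by blast
    have "z - h < z" using h 3 by simp
    from less.IH[OF this 1(2)] obtain n e' f' d' where
      2: "z - h = h * n" "d'\<^sup>2 = d\<^sup>2" "prim_rep D q 0 e' f'" "qi D e f = qi D e' f' * qi D c d' ^ n"
      by blast
    have z: "z = h * Suc n" using 2(1) 3 by simp
    show ?thesis
    proof (cases "n = 0 \<or> d' = d1")
      case True
      then have "qi D a b = qi D e' f' * qi D c d1 ^ Suc n" using 1(3) 2(4) by auto
      then show ?thesis using z 1(1) 2(3) by blast
    next
      \<comment> \<open>Using both the generator and its conjugate would produce the factor q^h,
        contrary to primitivity.\<close>
      case False
      then obtain l where l: "n = Suc l" by (cases n) auto
      have "d' = - d1" using False 1(1) 2(2) by (metis power2_eq_iff)
      moreover have "c\<^sup>2 + D * d1\<^sup>2 = int q ^ h" using g 1(1) by (simp add: prim_rep_def)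
      ultimately have "qi D c d1 * qi D c d' = of_int (int q ^ h)" using qi_norm[OF D(1)] by metis
      moreover obtain u v where "qi D c d' ^ l = qi D u v" using qi_power_ex[OF D(1)] by blast
      ultimately have "qi D a b = of_int (int q ^ h) * (qi D e' f' * qi D u v)"
        using 1(3) 2(4) l by (simp add: mult_ac)
      then obtain x y where "qi D a b = of_int (int q ^ h) * qi D x y" using qi_mult[OF D(1)] by metis
      then have "a = int q ^ h * x" by (simp only: qi_mult_of_int[OF D(1)] qi_eq_iff[OF D(1)])
      then have "int q dvd a" using h by simp
      then show ?thesis using prim_rep_not_dvd(1)[OF q(1) D(2) less.prems] 3 h by simp
    qed
  qed
qed

text \<open>Since n^2 is 1 modulo 4, a unit \<open>u\<close> is an \<open>n\<close>-th power of a
  unit and can be absorbed into the base of an \<open>n\<close>-th power.\<close>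

lemma odd_power_unit:
  fixes u :: "'a :: comm_monoid_mult"
  assumes "u ^ 4 = 1" "odd n"
  shows "(u ^ n) ^ n = u"
proof -
  obtain k where "n = 2 * k + 1" using assms(2) by (elim oddE)
  then have "n * n = 4 * (k * k + k) + 1" by (simp add: algebra_simps)
  then have "(u ^ n) ^ n = u ^ (4 * (k * k + k) + 1)" by (simp only: power_mult[symmetric])
  also have "\<dots> = u" by (simp only: power_add power_mult assms(1)) simp
  finally show ?thesis .
qed

lemma qi_norm_power:
  assumes "D > 0" "qi D a b ^ n = qi D e f"
  shows "e\<^sup>2 + D * f\<^sup>2 = (a\<^sup>2 + D * b\<^sup>2) ^ n"
proof -
  have "qi D a (- b) ^ n = qi D e (- f)"
    using arg_cong[OF assms(2), of cnj] by (simp add: qi_cnj)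
  then have "qi D e f * qi D e (- f) = (qi D a b * qi D a (- b)) ^ n"
    using assms(2) by (simp add: power_mult_distrib)
  then have "complex_of_int (e\<^sup>2 + D * f\<^sup>2) = of_int ((a\<^sup>2 + D * b\<^sup>2) ^ n)"
    unfolding qi_norm[OF assms(1)] by (simp only: of_int_power)
  then show ?thesis by (simp only: of_int_eq_iff)
qed

text \<open>Take for \<open>h\<close> the least positive exponent with a primitive representation,
  so that it depends only on \<open>D\<close> and \<open>q\<close>. An odd \<open>z\<close> makes
  the quotient by \<open>h\<close> odd, and the unit is then absorbed into the base.\<close>

lemma prim_rep_odd_power:
  assumes D: "D > 0" "\<not> int q dvd D" and q: "prime q" "odd q"
  obtains h where
    "\<And>z a b. odd z \<Longrightarrow> prim_rep D q z a b \<Longrightarrow>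
       \<exists>m c d. z = h * (2 * m + 1) \<and> c\<^sup>2 + D * d\<^sup>2 = int q ^ h \<and> qi D a b = qi D c d ^ (2 * m + 1)"
proof (cases "\<exists>h > 0. \<exists>c d. prim_rep D q h c d")
  case False
  \<comment> \<open>Without any representation of positive exponent the claim is vacuous, and 0
    serves as a dummy value.\<close>
  then show ?thesis using that[of 0] odd_pos by blast
next
  case True
  define h where "h = (LEAST h. h > 0 \<and> (\<exists>c d. prim_rep D q h c d))"
  have "h > 0 \<and> (\<exists>c d. prim_rep D q h c d)" unfolding h_def by (rule LeastI_ex) (use True in blast)
  then obtain c d where h: "h > 0" and g: "prim_rep D q h c d" by blast
  have least: "\<not> prim_rep D q n a b" if "0 < n" "n < h" for n a b
    using not_less_Least[of n "\<lambda>h. h > 0 \<and> (\<exists>c d. prim_rep D q h c d)"] that unfolding h_def by blast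
  show ?thesis
  proof (rule that[of h])
    fix z a b assume z: "odd z" and r: "prim_rep D q z a b"
    obtain n e f d' where *: "z = h * n" "d'\<^sup>2 = d\<^sup>2" "prim_rep D q 0 e f" "qi D a b = qi D e f * qi D c d' ^ n"
      using prim_rep_generator[OF D q h g least r] by blast
    have "odd n" using z *(1) by simp
    then obtain m where m: "n = 2 * m + 1" by (elim oddE)
    obtain u v where uv: "qi D e f ^ n = qi D u v" using qi_power_ex[OF D(1)] by blast
    have nuv: "u\<^sup>2 + D * v\<^sup>2 = 1"
      using qi_norm_power[OF D(1) uv] *(3) by (simp add: prim_rep_def)
    define c'' d'' where "c'' = u * c - D * v * d'" and "d'' = u * d' + v * c"
    have "qi D u v ^ n = qi D e f"
      using odd_power_unit[OF prim_rep_0_power4[OF D(1) *(3)] \<open>odd n\<close>] uv by simp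
    then have "qi D a b = (qi D u v * qi D c d') ^ n" using *(4) by (simp add: power_mult_distrib)
    also have "qi D u v * qi D c d' = qi D c'' d''" using D by (simp add: qi_mult c''_def d''_def)
    finally have "qi D a b = qi D c'' d'' ^ n" .
    moreover have "c''\<^sup>2 + D * d''\<^sup>2 = int q ^ h"
      using norm_mult_int[of u c D v d'] nuv *(2) g
      by (simp add: c''_def d''_def prim_rep_def)
    ultimately show "\<exists>m c d. z = h * (2 * m + 1) \<and> c\<^sup>2 + D * d\<^sup>2 = int q ^ h \<and> qi D a b = qi D c d ^ (2 * m + 1)"
      using *(1) m by blast
  qed
qed

section \<open>Uniqueness of the solution\<close>

text \<open>Size against divisibility: for n > 1 the bound gives n - 1 < 2e, while p^e dividing
  \<open>n\<close> gives n >= 5^e >= 4e + 1.\<close>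

lemma exponent_eq_1:
  fixes p Q n e :: nat
  assumes "5 \<le> p" "p < Q" "p ^ e dvd n" "n > 0" "Q ^ n \<le> Q * p ^ (2 * e)"
  shows "n = 1"
proof (rule ccontr)
  assume "n \<noteq> 1"
  then obtain r where r: "n = Suc r" "r > 0" using assms(4) by (cases n) auto
  have "p ^ r < Q ^ r" using assms r by (intro power_strict_mono) auto
  also have "Q ^ r \<le> p ^ (2 * e)" using assms(2,5) r by simp
  finally have "r < 2 * e" using assms(1) by (simp add: power_strict_increasing_iff)
  have "4 * e + 1 \<le> (5::nat) ^ e" by (induction e) auto
  also have "\<dots> \<le> p ^ e" using assms(1) by (intro power_mono) auto
  also have "\<dots> \<le> n" using assms(3,4) by (rule dvd_imp_le)
  finally show False using r \<open>r < 2 * e\<close> by simp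
qed

lemma int_mult_eq_prime_power:
  fixes p :: nat and c d :: int
  assumes "prime p" "int p ^ k = c * d"
  obtains i j where "\<bar>c\<bar> = int p ^ i" "\<bar>d\<bar> = int p ^ j" "k = i + j"
proof -
  have "p ^ k = nat \<bar>c\<bar> * nat \<bar>d\<bar>"
    using arg_cong[OF assms(2), of "\<lambda>x. nat \<bar>x\<bar>"] by (simp add: abs_mult nat_mult_distrib nat_power_eq power_abs)
  then have "nat \<bar>c\<bar> dvd p ^ k" "nat \<bar>d\<bar> dvd p ^ k" and eq: "p ^ k = nat \<bar>c\<bar> * nat \<bar>d\<bar>" by simp_all
  then obtain i j where ij: "nat \<bar>c\<bar> = p ^ i" "nat \<bar>d\<bar> = p ^ j"
    using divides_primepow_nat[OF assms(1)] by metis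
  then have "p ^ k = p ^ (i + j)" using eq by (simp add: power_add)
  then have "k = i + j" using assms(1) prime_gt_1_nat power_inject_exp by blast
  moreover have "\<bar>c\<bar> = int p ^ i" "\<bar>d\<bar> = int p ^ j" using ij by (metis abs_ge_zero int_nat_eq of_nat_power)+
  ultimately show ?thesis using that by blast
qed

lemma square_of_abs_eq: "\<bar>x\<bar> = a ^ n \<Longrightarrow> x\<^sup>2 = a ^ (2 * n)" for x a :: int
  by (metis power2_abs power_mult mult.commute)

section \<open>Uniqueness within each type and conclusion\<close>

context prime_pair
begin

lemma not_q_dvd: "\<not> q dvd p" "\<not> int q dvd int p" "\<not> q dvd 2" "\<not> q dvd 1"
proof -
  have "p \<noteq> q" using p_mod q_mod by auto
  then show "\<not> q dvd p" using primes_dvd_imp_eq[OF q p] by auto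
  then show "\<not> int q dvd int p" by simp
  show "\<not> q dvd 2" "\<not> q dvd 1" using q_ge by (auto dest: dvd_imp_le)
qed

lemma sol_parity:
  assumes "sol p q x y z" "sol p q x' y' z'"
  shows "even x \<longleftrightarrow> even x'"
proof -
  have c: "[int q ^ z = 2 ^ x] (mod int p)" if "sol p q x y z" for x y z
  proof -
    have "int (2 ^ x + p ^ y) = int (q ^ z)" "y > 0" using that by (auto simp: sol_def)
    then have "int q ^ z - 2 ^ x = int p ^ y" "y > 0" by auto
    then show ?thesis by (simp add: cong_iff_dvd_diff)
  qed
  have "[(int q ^ z) ^ z' = (2 ^ x) ^ z'] (mod int p)" "[(int q ^ z') ^ z = (2 ^ x') ^ z] (mod int p)"
    using c assms by (blast intro: cong_pow)+
  then have "[2 ^ (x * z') = 2 ^ (x' * z)] (mod int p)"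
    by (metis cong_sym cong_trans power_mult mult.commute)
  \<comment> \<open>Squaring passes to base 4, where exponents are determined modulo 2.\<close>
  then have "[(2 ^ (x * z')) ^ 2 = (2 ^ (x' * z)) ^ 2] (mod int p)" by (rule cong_pow)
  moreover have "(2 ^ n) ^ 2 = (4::int) ^ n" for n
    by (simp add: power2_eq_square flip: power_mult_distrib)
  ultimately have "even (x * z') \<longleftrightarrow> even (x' * z)"
    using four_power_cong_imp_parity[OF p p5, of "x * z'" "x' * z"] by simp
  then show ?thesis using sol_odd_z[OF assms(1)] sol_odd_z[OF assms(2)] by simp
qed

lemma sol_2_z_unique:
  obtains h where "\<And>y z. sol p q 2 y z \<Longrightarrow> z = h"
proof -
  have D: "int p > 0" using p_ge by simp
  from prim_rep_odd_power[OF D not_q_dvd(2) q odd_q] obtain h where h: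
    "\<And>z a b. odd z \<Longrightarrow> prim_rep (int p) q z a b \<Longrightarrow>
       \<exists>m c d. z = h * (2 * m + 1) \<and> c\<^sup>2 + int p * d\<^sup>2 = int q ^ h \<and> qi (int p) a b = qi (int p) c d ^ (2 * m + 1)"
    by blast
  show ?thesis
  proof (rule that[of h])
    fix y z assume sol: "sol p q 2 y z"
    have "odd z" using sol_odd_z[OF sol] .
    have "odd y" using sol by (cases rule: sol_cases) auto
    then obtain k where k: "y = 2 * k + 1" by (elim oddE)
    have "4 + p ^ y = q ^ z" using sol by (simp add: sol_def)
    then have eq: "4 + p * p ^ (2 * k) = q ^ z" by (simp add: k)
    have eqi: "4 + int p * (int p ^ k)\<^sup>2 = int q ^ z"
      using arg_cong[OF eq, of int] by (simp add: mult.commute[of 2] power_mult)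
    have "coprime (2::int) (int p ^ k)" using odd_p by simp
    with eqi have "prim_rep (int p) q z 2 (int p ^ k)" by (simp add: prim_rep_def)
    from h[OF \<open>odd z\<close> this] obtain m c d where
      1: "z = h * (2 * m + 1)" "c\<^sup>2 + int p * d\<^sup>2 = int q ^ h"
        "qi (int p) 2 (int p ^ k) = qi (int p) c d ^ (2 * m + 1)" by blast
    let ?X = "odd_binom m (c\<^sup>2) (- int p * d\<^sup>2)" and ?Y = "odd_binom m (- int p * d\<^sup>2) (c\<^sup>2)"
    have cd: "2 = c * ?X" "int p ^ k = d * ?Y"
      using 1(3) unfolding qi_odd_power[OF D] qi_eq_iff[OF D] by blast+
    obtain l e where l: "\<bar>d\<bar> = int p ^ l" and e: "\<bar>?Y\<bar> = int p ^ e" and kle: "k = l + e"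
      using int_mult_eq_prime_power[OF p cd(2)] by blast
    have d2: "d\<^sup>2 = int p ^ (2 * l)" using square_of_abs_eq[OF l] .
    have "int 2 ^ 1 = c * ?X" using cd(1) by simp
    then obtain i i' where i: "\<bar>c\<bar> = int 2 ^ i" "1 = i + i'"
      using int_mult_eq_prime_power[OF two_is_prime_nat] by metis
    \<comment> \<open>\<open>c\<close> divides 2, and the odd norm c^2 + p d^2 with \<open>d\<close>
      odd rules out c = 1 and c = -1.\<close>
    have "odd (int q ^ h)" "odd (int p * d\<^sup>2)" using odd_q odd_p d2 by auto
    then have "even c" using 1(2) by (metis even_add even_power odd_add pos2)
    then have "i \<noteq> 0" using i(1) by (metis abs_1 dvd_abs_iff odd_one power_0)
    then have "i = 1" using i(2) by linarith
    then have "\<bar>c\<bar> = 2" using i(1) by simp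
    then have c2: "c\<^sup>2 = 4" by (metis numeral_Bit0_eq_double power2_abs power2_eq_square mult_2 numeral_Bit0)
    have "int p ^ e dvd ?Y" using e by (metis dvd_abs_iff dvd_refl)
    moreover have "\<not> int p dvd c\<^sup>2" unfolding c2 using p_ge by (auto dest: zdvd_imp_le)
    ultimately have pe: "p ^ e dvd 2 * m + 1"
      using p p_ge by (intro odd_binom_lte[of p "- int p * d\<^sup>2" "c\<^sup>2"]) auto
    have "int (q ^ h) = int (4 + p * p ^ (2 * l))" using 1(2) c2 d2 by simp
    then have qh: "q ^ h = 4 + p * p ^ (2 * l)" by (simp only: of_nat_eq_iff)
    \<comment> \<open>Passing from the norm of the base to that of its power multiplies the
      \<open>p\<close>-part by exactly p^(2e), which bounds the growth; \<open>pe\<close> supplies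
      the opposing divisibility.\<close>
    have "(q ^ h) ^ (2 * m + 1) = 4 + p * p ^ (2 * l) * p ^ (2 * e)"
      unfolding power_mult[symmetric] 1(1)[symmetric] eq[symmetric] kle by (simp add: power_add algebra_simps)
    also have "\<dots> \<le> q ^ h * p ^ (2 * e)"
      unfolding qh using p_ge by (simp add: algebra_simps)
    finally have le: "(q ^ h) ^ (2 * m + 1) \<le> q ^ h * p ^ (2 * e)" .
    have "p * 1 \<le> p * p ^ (2 * l)" using p_ge by (intro mult_le_mono2) simp
    then have "p < q ^ h" unfolding qh by linarith
    then have "2 * m + 1 = 1" using exponent_eq_1[OF p_ge _ pe _ le] by simp
    then show "z = h" using 1(1) by simp
  qed
qed

lemma sol_even_y_z_unique:
  fixes D :: nat
  assumes D12: "D = 1 \<or> D = 2"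
  obtains h where "\<And>j k z. D * 4 ^ j + p ^ (2 * k) = q ^ z \<Longrightarrow> odd z \<Longrightarrow> j > 0 \<Longrightarrow> k > 0 \<Longrightarrow> z = h"
proof -
  have D: "int D > 0" "\<not> int q dvd int D" using D12 not_q_dvd by auto
  from prim_rep_odd_power[OF D q odd_q] obtain h where h:
    "\<And>z a b. odd z \<Longrightarrow> prim_rep (int D) q z a b \<Longrightarrow>
       \<exists>m c d. z = h * (2 * m + 1) \<and> c\<^sup>2 + int D * d\<^sup>2 = int q ^ h \<and> qi (int D) a b = qi (int D) c d ^ (2 * m + 1)"
    by blast
  show ?thesis
  proof (rule that[of h])
    fix j k z assume eq: "D * 4 ^ j + p ^ (2 * k) = q ^ z" and "odd z" and j: "j > 0" and k: "k > 0"
    have sq: "(2 ^ j)\<^sup>2 = (4::int) ^ j" by (simp add: power2_eq_square flip: power_mult_distrib)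
    have eqi: "(int p ^ k)\<^sup>2 + int D * (2 ^ j)\<^sup>2 = int q ^ z"
      using arg_cong[OF eq, of int] by (simp add: mult.commute[of 2] power_mult sq)
    have "coprime (int p ^ k) (2 ^ j)" using odd_p by simp
    with eqi have "prim_rep (int D) q z (int p ^ k) (2 ^ j)" by (simp add: prim_rep_def)
    from h[OF \<open>odd z\<close> this] obtain m c d where
      1: "z = h * (2 * m + 1)" "c\<^sup>2 + int D * d\<^sup>2 = int q ^ h"
        "qi (int D) (int p ^ k) (2 ^ j) = qi (int D) c d ^ (2 * m + 1)" by blast
    let ?X = "odd_binom m (c\<^sup>2) (- int D * d\<^sup>2)" and ?Y = "odd_binom m (- int D * d\<^sup>2) (c\<^sup>2)"
    have cd: "int p ^ k = c * ?X" "2 ^ j = d * ?Y"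
      using 1(3) unfolding qi_odd_power[OF D(1)] qi_eq_iff[OF D(1)] by blast+
    obtain l e where l: "\<bar>c\<bar> = int p ^ l" and e: "\<bar>?X\<bar> = int p ^ e" and kle: "k = l + e"
      using int_mult_eq_prime_power[OF p cd(1)] by blast
    have c2: "c\<^sup>2 = int p ^ (2 * l)" using square_of_abs_eq[OF l] .
    have "int 2 ^ j = d * ?Y" using cd(2) by simp
    then obtain i i' where i: "\<bar>d\<bar> = int 2 ^ i" "\<bar>?Y\<bar> = int 2 ^ i'" "j = i + i'"
      using int_mult_eq_prime_power[OF two_is_prime_nat] by metis
    have d2i: "d\<^sup>2 = 4 ^ i" using square_of_abs_eq[OF i(1)] by (simp add: power_mult)

    \<comment> \<open>An odd \<open>d\<close> would be 1 or -1, making q^h equal 1 + D modulo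
      8.\<close>
    have "even d"
    proof (rule ccontr)
      assume "odd d"
      have "even \<bar>d\<bar>" if "i \<noteq> 0" unfolding i(1) using that by simp
      then have "i = 0" using \<open>odd d\<close> by auto
      then have "int (q ^ h) = int (p ^ (2 * l) + D)" using 1(2) c2 d2i by simp
      then have "q ^ h = p ^ (2 * l) + D" by (simp only: of_nat_eq_iff)
      moreover have "p ^ (2 * l) mod 8 = 1" using p_power_mod[of "2 * l"] by simp
      ultimately have "(1 + D) mod 8 = 1" using q_power_mod[of h] by (metis mod_add_left_eq)
      then show False using D12 by auto
    qed
    then have d4: "4 dvd d\<^sup>2" using mult_dvd_mono[of 2 d 2 d] by (simp add: power2_eq_square)
    \<comment> \<open>With \<open>d\<close> even and \<open>c\<close> odd the cofactor is odd; being
      a power of 2 up to sign, it is 1 or -1, and \<open>d\<close> carries the whole power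
      2^j.\<close>
    have Ycong: "[?Y = int (2 * m + 1) * (c\<^sup>2) ^ m] (mod (- int D * d\<^sup>2))"
      by (rule odd_binom_cong)
    have "odd c" using l odd_p by (metis dvd_abs_iff even_of_nat even_power)
    have "2 dvd - int D * d\<^sup>2" using \<open>even d\<close> by simp
    then have "[?Y = int (2 * m + 1) * (c\<^sup>2) ^ m] (mod 2)" using Ycong cong_dvd_modulus by blast
    moreover have "odd (int (2 * m + 1) * (c\<^sup>2) ^ m)" using \<open>odd c\<close> by simp
    ultimately have "odd ?Y" using cong_dvd_iff by blast
    moreover have "even \<bar>?Y\<bar>" if "i' \<noteq> 0" unfolding i(2) using that by simp
    ultimately have "i' = 0" by auto
    then have d2: "d\<^sup>2 = 4 ^ j" and Y1: "\<bar>?Y\<bar> = 1" using d2i i by auto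

    have "int (q ^ h) = int (p ^ (2 * l) + D * 4 ^ j)" using 1(2) c2 d2 by simp
    then have qh: "q ^ h = p ^ (2 * l) + D * 4 ^ j" by (simp only: of_nat_eq_iff)
    have qz: "q ^ z = (q ^ h) ^ (2 * m + 1)" unfolding 1(1) power_mult ..
    show "z = h"
    proof (cases "l = 0")
      case False
      have "int p ^ e dvd ?X" using e by (metis dvd_abs_iff dvd_refl)
      moreover have "\<not> int p dvd - int D * d\<^sup>2"
      proof
        assume "int p dvd - int D * d\<^sup>2"
        then have "int p dvd int (D * 4 ^ j)" by (simp add: d2)
        then have "p dvd D * 4 ^ j" by (simp only: int_dvd_int_iff)
        then have "p dvd D \<or> p dvd 4" using p by (metis prime_dvd_mult_iff prime_dvd_power)
        then show False using D12 p_ge by (auto dest: dvd_imp_le)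
      qed
      moreover have "int p dvd c\<^sup>2" using False c2 by simp
      ultimately have pe: "p ^ e dvd 2 * m + 1"
        using p p_ge by (intro odd_binom_lte[of p "c\<^sup>2" "- int D * d\<^sup>2"]) auto
      have "p \<le> p ^ (2 * l)" using power_increasing[of 1 "2 * l" p] False p_ge by simp
      moreover have "D * 4 ^ j > 0" using D12 by auto
      ultimately have "p < q ^ h" unfolding qh by linarith
      have "(q ^ h) ^ (2 * m + 1) = p ^ (2 * l) * p ^ (2 * e) + D * 4 ^ j"
        unfolding qz[symmetric] eq[symmetric] kle by (simp add: power_add algebra_simps)
      also have "\<dots> \<le> q ^ h * p ^ (2 * e)"
        unfolding qh using p_ge by (simp add: algebra_simps)
      finally have "(q ^ h) ^ (2 * m + 1) \<le> q ^ h * p ^ (2 * e)" .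
      then have "2 * m + 1 = 1" using exponent_eq_1[OF p_ge \<open>p < q ^ h\<close> pe] by simp
      then show "z = h" using 1(1) by simp
    next
      txt \<open>Here \<open>q^h = 1 + D 4^j\<close> and \<open>p\<close>-adic information is lost.\<close>
      case True
      have D1: "D = 1"
      proof (rule ccontr)
        assume "D \<noteq> 1"
        then have "int (q ^ h) = 1 + 2 * 4 ^ j" using D12 qh True by simp
        moreover have "[1 + 2 * 4 ^ j = 1 + 2 * 1 ^ j] (mod (3::int))"
          by (intro cong_add cong_mult cong_pow) (auto simp: cong_def)
        ultimately have "3 dvd int (q ^ h)" by (simp add: cong_def dvd_eq_mod_eq_0)
        then have "3 dvd q ^ h" by (metis int_dvd_int_iff of_nat_numeral)
        then have "3 dvd q" by (rule prime_dvd_power[rotated]) simp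
        then show False using primes_dvd_imp_eq[of 3 q] q q_ge by simp
      qed
      have qh': "int q ^ h = 1 + 4 ^ j" using qh True D1 by (metis int_ops(2) mult_1 mult_is_0 of_nat_add of_nat_numeral of_nat_power power_0)
      have four: "[(4::int) ^ j = (-1) ^ j] (mod 5)" by (rule cong_pow) (simp add: cong_def)
      have "even j"
      proof (rule ccontr)
        assume "odd j"
        then have "[1 + 4 ^ j = 1 + (-1)] (mod (5::int))" using four by (intro cong_add) auto
        then have "5 dvd int q ^ h" unfolding qh' by (simp add: cong_0_iff)
        then have "5 dvd q ^ h" by (metis int_dvd_int_iff of_nat_numeral of_nat_power)
        then have "5 dvd q" by (rule prime_dvd_power[rotated]) simp
        then show False using primes_dvd_imp_eq[of 5 q] q q_ge by simp
      qed
      then have four1: "[(4::int) ^ j = 1] (mod 5)" using four by simp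
      have "[int q ^ h = 1 + 1] (mod 5)" unfolding qh' using four1 by (intro cong_add) auto
      then have "[(int q ^ h) ^ (2 * m + 1) = 2 ^ (2 * m + 1)] (mod 5)" by (intro cong_pow) simp
      also have "2 ^ (2 * m + 1) = (2::int) * 4 ^ m" by (simp add: power_mult)
      also have "[2 * 4 ^ m = 2 * (-1) ^ m] (mod (5::int))"
        by (intro cong_mult cong_pow) (auto simp: cong_def)
      finally have "[int q ^ z = 2 * (-1) ^ m] (mod 5)" by (simp only: 1(1) power_mult)
      then have "[int q ^ z - 4 ^ j = 2 * (-1) ^ m - 1] (mod 5)" using four1 by (rule cong_diff)
      moreover have "int q ^ z - 4 ^ j = (int p ^ k)\<^sup>2" using eqi D1 sq by simp
      \<comment> \<open>Here q^h is 2 modulo 5. An odd \<open>m\<close> would make the square p^(2k)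
        congruent to -3 = 2, a non-residue modulo 5.\<close>
      ultimately have P: "(int p ^ k)\<^sup>2 mod 5 = (2 * (-1) ^ m - 1) mod 5" by (simp add: cong_def)
      have "even m"
      proof (rule ccontr)
        assume "odd m"
        then have P2: "(int p ^ k)\<^sup>2 mod 5 = 2" using P by simp
        have "(int p ^ k) mod 5 \<in> {0..<5}" by simp
        also have "{0..<5::int} = {0,1,2,3,4}" by auto
        finally have "(int p ^ k mod 5)\<^sup>2 mod 5 \<in> {0,1,4}" by auto
        then show False using P2 by (simp add: power_mod)
      qed
      have "c\<^sup>2 = 1" using c2 True by simp
      have "4 dvd - int D * d\<^sup>2" using d4 by simp
      \<comment> \<open>Even \<open>m\<close> fixes the sign: the cofactor is 1 modulo 4, so it
        equals 1 and the 2-adic lemma applies.\<close>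
      then have "[?Y = int (2 * m + 1)] (mod 4)" using Ycong \<open>c\<^sup>2 = 1\<close> cong_dvd_modulus by fastforce
      moreover have "[int (2 * m + 1) = 1] (mod 4)" using \<open>even m\<close> by (auto elim!: evenE simp: cong_iff_dvd_diff)
      ultimately have "[?Y = 1] (mod 4)" by (rule cong_trans)
      then have "?Y \<noteq> -1" by (auto simp: cong_def)
      then have "odd_binom m (- int D * d\<^sup>2) 1 = 1" using Y1 \<open>c\<^sup>2 = 1\<close> by auto
      then have "m = 0" by (rule odd_binom_eq_one[rotated]) (use d4 in simp)
      then show "z = h" using 1(1) by simp
    qed
  qed
qed

lemma sol_even_y_unique:
  fixes D :: nat
  assumes D12: "D = 1 \<or> D = 2"
    and 1: "D * 4 ^ j + p ^ (2 * k) = q ^ z" "odd z" "j > 0" "k > 0"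
    and 2: "D * 4 ^ j' + p ^ (2 * k') = q ^ z'" "odd z'" "j' > 0" "k' > 0"
  shows "j = j' \<and> k = k' \<and> z = z'"
proof -
  obtain h where h: "\<And>j k z. D * 4 ^ j + p ^ (2 * k) = q ^ z \<Longrightarrow> odd z \<Longrightarrow> j > 0 \<Longrightarrow> k > 0 \<Longrightarrow> z = h"
    using sol_even_y_z_unique[OF D12] by blast
  have z: "z = z'" using h[OF 1] h[OF 2] by simp
  have D: "int D > 0" "\<not> int q dvd int D" using D12 not_q_dvd by auto
  have rep: "prim_rep (int D) q z (int p ^ k) (2 ^ j)" if "D * 4 ^ j + p ^ (2 * k) = q ^ z" for j k
  proof -
    have sq: "(2 ^ j)\<^sup>2 = (4::int) ^ j" by (simp add: power2_eq_square flip: power_mult_distrib)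
    have "(int p ^ k)\<^sup>2 + int D * (2 ^ j)\<^sup>2 = int q ^ z"
      using arg_cong[OF that, of int] by (simp add: mult.commute[of 2] power_mult sq)
    then show ?thesis using odd_p by (simp add: prim_rep_def)
  qed
  have "\<bar>int p ^ k\<bar> = \<bar>int p ^ k'\<bar> \<and> \<bar>2 ^ j :: int\<bar> = \<bar>2 ^ j'\<bar> \<or>
      int D = 1 \<and> \<bar>int p ^ k\<bar> = \<bar>2 ^ j' :: int\<bar> \<and> \<bar>2 ^ j :: int\<bar> = \<bar>int p ^ k'\<bar>"
    using prim_rep_norm_unique[OF D q odd_q rep[OF 1(1)] rep[OF 2(1)[folded z]]] .
  \<comment> \<open>Parity excludes the swapped representation possible for D = 1.\<close>
  moreover have "int p ^ k \<noteq> 2 ^ j'"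
  proof
    assume "int p ^ k = 2 ^ j'"
    then have "even (int p ^ k)" using 2(3) by simp
    then show False using odd_p by simp
  qed
  ultimately have "p ^ k = p ^ k'" "(2::nat) ^ j = 2 ^ j'"
    by (auto simp: power_abs simp flip: of_nat_power)
  then show ?thesis using z p_ge by (simp add: power_inject_exp)
qed

lemma sol_2_high:
  assumes "sol p q 2 y z" "odd y" "sol p q x' y' z'" "x' \<ge> 3" "even y'"
  shows False
proof -
  obtain j where j: "x' = 2 * j" using sol_parity[OF assms(1,3)] by (auto elim: evenE)
  obtain k where k: "y' = 2 * k" using assms(5) by (elim evenE)
  show False
  proof (rule no_mixed_solutions)
    show "4 + p ^ y = q ^ z" using assms(1) by (simp add: sol_def)
    show "4 ^ j + p ^ (2 * k) = q ^ z'" using assms(3) by (simp add: sol_def j k power_mult)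
    show "k > 0" using assms(3) by (simp add: sol_def k)
    show "odd y" "odd z" "odd z'" using assms sol_odd_z by blast+
    show "j \<ge> 2" using assms(4) j by simp
  qed
qed

lemma sol_unique:
  assumes s: "sol p q x y z" and s': "sol p q x' y' z'"
  shows "x = x' \<and> y = y' \<and> z = z'"
  using s
proof (cases rule: sol_cases)
  case 1
  from s' show ?thesis
  proof (cases rule: sol_cases)
    case c1: 1
    obtain h where "\<And>y z. sol p q 2 y z \<Longrightarrow> z = h" using sol_2_z_unique by blast
    then have "z = z'" using s s' 1 c1 by metis
    then have "p ^ y = p ^ y'" using s s' 1 c1 by (auto simp: sol_def)
    then show ?thesis using \<open>z = z'\<close> 1 c1 p_ge by (simp add: power_inject_exp)
  next
    case 2
    then show ?thesis using sol_2_high s s' 1 by metis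
  qed
next
  case 2
  from s' show ?thesis
  proof (cases rule: sol_cases)
    case 1
    then show ?thesis using sol_2_high s s' 2 by metis
  next
    case c2: 2
    obtain k k' where k: "y = 2 * k" "y' = 2 * k'" using 2 c2 by (auto elim!: evenE)
    \<comment> \<open>\<open>D\<close> absorbs the parity of \<open>x\<close>, turning 2^x into D
      times a power of 4; by \<open>sol_parity\<close> the same \<open>D\<close> serves both
      solutions.\<close>
    define D :: nat where "D = (if even x then 1 else 2)"
    have ex: "\<exists>j>0. 2 ^ u = D * 4 ^ j \<and> u = 2 * j + (D - 1)" if "u \<ge> 3" "even u \<longleftrightarrow> even x" for u
    proof (intro exI[of _ "u div 2"] conjI)
      show "u div 2 > 0" using that by simp
      show u: "u = 2 * (u div 2) + (D - 1)" using that by (auto simp: D_def)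
      have "(2::nat) ^ u = 2 ^ (D - 1) * 4 ^ (u div 2)"
        by (subst u) (simp add: power_add power_mult mult.commute)
      then show "2 ^ u = D * 4 ^ (u div 2)" by (simp add: D_def)
    qed
    obtain j where j: "j > 0" "2 ^ x = D * 4 ^ j" "x = 2 * j + (D - 1)" using ex[of x] 2 by blast
    obtain j' where j': "j' > 0" "2 ^ x' = D * 4 ^ j'" "x' = 2 * j' + (D - 1)"
      using ex[of x'] c2 sol_parity[OF s s'] by blast
    have "j = j' \<and> k = k' \<and> z = z'"
      by (rule sol_even_y_unique[of D])
        (use s s' j(1,2) j'(1,2) k sol_odd_z[OF s] sol_odd_z[OF s'] in \<open>auto simp: sol_def D_def\<close>)
    then show ?thesis using j(3) j'(3) k by simp
  qed
qed

end

theorem proposition4p1: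
  fixes p q :: nat
  assumes "prime p" and "prime q"
    and "[p = 5] (mod 8)" and "[q = 1] (mod 8)"
  shows "\<exists>\<^sub>\<le>\<^sub>1(x :: nat, y :: nat, z :: nat).
           x > 0 \<and> y > 0 \<and> z > 0 \<and> 2 ^ x + p ^ y = q ^ z"
proof -
  interpret prime_pair p q using assms by unfold_locales
  show ?thesis
    unfolding Uniq_def split_paired_all split_paired_All split_conv sol_def[symmetric] prod.inject
    using sol_unique by blast
qed

end
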